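(* Let $n\ge 1$. We have the following isomorphisms of posets: (1) $D_n^0\cong \mathsf{Div}(\Delta_{n-1})$, and $D_n^{n+1}\cong\mathsf{Div}(\Delta_0)=\{\bullet\}$ (a one-element poset); (2) for all $1\le i\le n$, $D_n^i\cong\mathsf{Div}(\Delta_{n-i})$. Here every set is ordered by the restriction of the left-divisibility order of the monoid $M_k$ for the suitable $k$ (that is, $D_n^i$ by left-divisibility in $M_n$ and $\mathsf{Div}(\Delta_k)$ by left-divisibility in $M_k$).
   Context: $M_0$ is the trivial monoid with $\Delta_0=1$. For $n\ge 1$, let $M_n$ be the monoid with presentation $\langle \rho_1,\dots,\rho_n \mid \rho_1\rho_n\rho_i=\rho_{i+1}\rho_n \text{ for all } 1\le i\le n-1\rangle$. For $a,b\in M_n$ write $a\le b$ ($a$ left-divides $b$) if there is $c\in M_n$ with $ac=b$; this is a partial order on $M_n$. For $n\ge 1$ let $\Delta_n:=\rho_n^{n+1}$. $\mathsf{Div}(\Delta_n)$ is the finite set of left divisors of $\Delta_n$ in $M_n$ (it coincides with the set of right divisors). For $x\in \mathsf{Div}(\Delta_n)$ with $n\geq 1$ let $d(x):=\max\{k\ge 0\mid \rho_n^k\le x\}$, and for $0\le i\le n+1$ let $D_n^i:=\{x\in\mathsf{Div}(\Delta_n)\mid d(x)=i\}$. *)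

theory Defs
  imports "HOL-Algebra.Divisibility"
begin

text \<open>The congruence on the free monoid of words over \<open>X\<close> generated by a set of relations
  \<open>R \<subseteq> lists X \<times> lists X\<close>, and the monoid presented by \<open>X\<close> and \<open>R\<close>, whose elements are
  congruence classes of words.\<close>

inductive_set pres_cong :: "'a set \<Rightarrow> ('a list \<times> 'a list) set \<Rightarrow> ('a list \<times> 'a list) set"
  for X :: "'a set" and R :: "('a list \<times> 'a list) set"
where
  rel: "(u, v) \<in> R \<Longrightarrow> (u, v) \<in> pres_cong X R"
| refl: "w \<in> lists X \<Longrightarrow> (w, w) \<in> pres_cong X R"
| sym: "(u, v) \<in> pres_cong X R \<Longrightarrow> (v, u) \<in> pres_cong X R"
| trans: "(u, v) \<in> pres_cong X R \<Longrightarrow> (v, w) \<in> pres_cong X R \<Longrightarrow> (u, w) \<in> pres_cong X R"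
| mult: "(u, v) \<in> pres_cong X R \<Longrightarrow> (u', v') \<in> pres_cong X R
          \<Longrightarrow> (u @ u', v @ v') \<in> pres_cong X R"

definition presented_monoid :: "'a set \<Rightarrow> ('a list \<times> 'a list) set \<Rightarrow> 'a list set monoid" where
  "presented_monoid X R =
     \<lparr>carrier = lists X // pres_cong X R,
      monoid.mult = (\<lambda>A B. \<Union>u\<in>A. \<Union>v\<in>B. pres_cong X R `` {u @ v}),
      one = pres_cong X R `` {[]}\<rparr>"

text \<open>The letter \<open>i\<close> stands for \<open>\<rho>\<^sub>i\<close>. For \<open>n = 0\<close> there are no generators, so \<open>M 0\<close> is trivial.\<close>

definition M_rels :: "nat \<Rightarrow> (nat list \<times> nat list) set" where
  "M_rels n = {([1, n, i], [i + 1, n]) | i. 1 \<le> i \<and> i < n}"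

definition M :: "nat \<Rightarrow> nat list set monoid" where
  "M n = presented_monoid {1..n} (M_rels n)"

definition rho :: "nat \<Rightarrow> nat \<Rightarrow> nat list set" where
  "rho n i = pres_cong {1..n} (M_rels n) `` {[i]}"

definition Delta :: "nat \<Rightarrow> nat list set" where
  "Delta n = (if n = 0 then \<one>\<^bsub>M 0\<^esub> else rho n n [^]\<^bsub>M n\<^esub> (n + 1))"

definition Div_Delta :: "nat \<Rightarrow> nat list set set" where
  "Div_Delta n = {x \<in> carrier (M n). x divides\<^bsub>M n\<^esub> Delta n}"

text \<open>For \<open>n \<ge> 1\<close> the set below is finite: the relations are homogeneous if \<open>\<rho>\<^sub>i\<close> has weight \<open>i\<close>,
  and \<open>\<rho>\<^sub>n\<close> has positive weight.\<close>

definition d :: "nat \<Rightarrow> nat list set \<Rightarrow> nat" where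
  "d n x = Max {k. (rho n n [^]\<^bsub>M n\<^esub> k) divides\<^bsub>M n\<^esub> x}"

definition D :: "nat \<Rightarrow> nat \<Rightarrow> nat list set set" where
  "D n i = {x \<in> Div_Delta n. d n x = i}"

definition div_poset :: "nat \<Rightarrow> nat list set set \<Rightarrow> nat list set gorder" where
  "div_poset n S = \<lparr>carrier = S, eq = (=), le = (\<lambda>x y. x divides\<^bsub>M n\<^esub> y)\<rparr>"

definition poset_isomorphic :: "'a gorder \<Rightarrow> 'b gorder \<Rightarrow> bool" where
  "poset_isomorphic P Q \<longleftrightarrow> partial_order P \<and> partial_order Q \<and>
     (\<exists>f. bij_betw f (carrier P) (carrier Q) \<and>
       (\<forall>x\<in>carrier P. \<forall>y\<in>carrier P. x \<sqsubseteq>\<^bsub>P\<^esub> y \<longleftrightarrow> f x \<sqsubseteq>\<^bsub>Q\<^esub> f y))"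

end

theory Submission
  imports Defs
begin

text \<open>
  Put \<open>y = \<rho>\<^sub>n\<close>, \<open>x = \<rho>\<^sub>1 \<rho>\<^sub>n\<close> and \<open>\<rho>\<^sub>0 = 1\<close>. The relations say \<open>x \<rho>\<^sub>i = \<rho>\<^bsub>i+1\<^esub> y\<close>, whence
  \<open>x\<^sup>b \<rho>\<^sub>i = \<rho>\<^bsub>i+b\<^esub> y\<^sup>b\<close> and \<open>\<Delta>\<^sub>n = x\<^sup>n\<close>. Garside's argument (induction on the weight, then on the
  number of relations applied) shows that \<open>M\<^sub>n\<close> is left cancellative and that the least common
  multiple of \<open>\<rho>\<^sub>a\<close> and \<open>\<rho>\<^sub>b\<close> with \<open>b < a\<close> is \<open>\<rho>\<^sub>a y\<^sup>b = \<rho>\<^sub>b y\<^sup>b \<rho>\<^bsub>a-b\<^esub>\<close>. From this one gets that, for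
  \<open>k < g \<le> n\<close> and \<open>u\<close> not divisible by \<open>y\<close>, every left divisor of \<open>\<rho>\<^sub>g y\<^sup>k u\<close> that is not divisible by
  \<open>\<rho>\<^sub>g\<close> divides \<open>x\<^sup>k\<close>. Hence, writing \<open>I\<^sub>m\<close> for the set of left divisors of \<open>x\<^sup>m\<close>,
  \<open>D\<^sub>n\<^sup>0 = I\<^bsub>n-1\<^esub>\<close> and \<open>D\<^sub>n\<^sup>i = y\<^sup>i I\<^bsub>n-i\<^esub>\<close>. For \<open>1 \<le> m \<le> n\<close> the poset \<open>I\<^sub>m\<close> is the disjoint
  union of \<open>I\<^bsub>m-1\<^esub>\<close>, of the sets \<open>\<rho>\<^sub>m y\<^bsup>i-1\<^esup> I\<^bsub>m-i\<^esub>\<close> for \<open>1 \<le> i \<le> m\<close> and of \<open>{x\<^sup>m}\<close>, and the order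
  between different pieces is expressed by the powers of \<open>x\<close> alone. By induction on \<open>m\<close>, the poset
  \<open>I\<^sub>m\<close> does not depend on \<open>n \<ge> m\<close>; for \<open>n = m\<close> it is \<open>Div(\<Delta>\<^sub>m)\<close>.
\<close>

subsection \<open>Presented monoids\<close>

declare in_lists_conv_set [simp del] in_listsI [rule del] in_listsD [rule del]

lemma pres_cong_lists:
  assumes "R \<subseteq> lists X \<times> lists X" "(u, v) \<in> pres_cong X R"
  shows "u \<in> lists X \<and> v \<in> lists X"
  using assms(2) by induction (use assms(1) in auto)

lemma equiv_pres_cong:
  assumes "R \<subseteq> lists X \<times> lists X"
  shows "equiv (lists X) (pres_cong X R)"
proof (rule equivI)
  show "pres_cong X R \<subseteq> lists X \<times> lists X"
    using pres_cong_lists[OF assms] by auto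
  show "refl_on (lists X) (pres_cong X R)"
    by (auto intro: refl_onI pres_cong.refl)
  show "sym (pres_cong X R)" by (auto intro: symI pres_cong.sym)
  show "trans (pres_cong X R)" by (auto intro: transI pres_cong.trans)
qed

text \<open>Chains of these steps carry the inner induction of \<open>M_lcm_below\<close>, in which
  the first letter of the word is followed along.\<close>

inductive_set word_step :: "'a set \<Rightarrow> ('a list \<times> 'a list) set \<Rightarrow> ('a list \<times> 'a list) set"
  for X R where
  "\<lbrakk>(l, l') \<in> R \<or> (l', l) \<in> R; p \<in> lists X; s \<in> lists X\<rbrakk> \<Longrightarrow> (p @ l @ s, p @ l' @ s) \<in> word_step X R"

lemma word_step_append:
  assumes "(u, v) \<in> word_step X R" "p \<in> lists X" "s \<in> lists X"
  shows "(p @ u @ s, p @ v @ s) \<in> word_step X R"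
  using assms(1)
proof cases
  case (1 l l' p' s')
  then show ?thesis
    using word_step.intros[of l l' R "p @ p'" X "s' @ s"] assms by simp
qed

lemma word_steps_append:
  assumes "(u, v) \<in> (word_step X R)\<^sup>*" "p \<in> lists X" "s \<in> lists X"
  shows "(p @ u @ s, p @ v @ s) \<in> (word_step X R)\<^sup>*"
  using assms(1)
proof induction
  case (step v w)
  show ?case
    by (rule rtrancl_into_rtrancl[OF step.IH word_step_append[OF step.hyps(2) assms(2,3)]])
qed simp

lemma sym_word_step: "sym (word_step X R)"
  by (rule symI, erule word_step.cases) (auto intro!: word_step.intros)

lemma pres_cong_word_steps:
  assumes R: "R \<subseteq> lists X \<times> lists X" and "(u, v) \<in> pres_cong X R"
  shows "(u, v) \<in> (word_step X R)\<^sup>*"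
  using assms(2)
proof induction
  case (rel u v)
  then show ?case using word_step.intros[of u v R "[]" X "[]"] by auto
next
  case (sym u v)
  then show ?case using sym_rtrancl[OF sym_word_step] by (meson symD)
next
  case (trans u v w)
  show ?case by (rule rtrancl_trans[OF trans.IH])
next
  case (mult u v u' v')
  have "u \<in> lists X" "v \<in> lists X" "u' \<in> lists X" "v' \<in> lists X"
    using mult.hyps pres_cong_lists[OF R] by blast+
  then have "(u @ u', v @ u') \<in> (word_step X R)\<^sup>*" "(v @ u', v @ v') \<in> (word_step X R)\<^sup>*"
    using word_steps_append[OF mult.IH(1), of "[]" u'] word_steps_append[OF mult.IH(2), of v "[]"]
    by simp_all
  then show ?case by (rule rtrancl_trans)
qed simp

text \<open>The product is a union over pairs of representatives; by compatibility with
  concatenation all its members are the same class, and the index sets are nonempty.\<close>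

lemma presented_monoid_mult:
  assumes R: "R \<subseteq> lists X \<times> lists X" and "u \<in> lists X" "v \<in> lists X"
  shows "pres_cong X R `` {u} \<otimes>\<^bsub>presented_monoid X R\<^esub> pres_cong X R `` {v} = pres_cong X R `` {u @ v}"
proof -
  note eq = equiv_class_eq[OF equiv_pres_cong[OF R]]
  have "pres_cong X R `` {u' @ v'} = pres_cong X R `` {u @ v}"
    if "u' \<in> pres_cong X R `` {u}" "v' \<in> pres_cong X R `` {v}" for u' v'
    using that by (auto intro!: eq[symmetric] pres_cong.mult)
  then have "(\<Union>u'\<in>pres_cong X R `` {u}. \<Union>v'\<in>pres_cong X R `` {v}. pres_cong X R `` {u' @ v'})
      = (\<Union>u'\<in>pres_cong X R `` {u}. \<Union>v'\<in>pres_cong X R `` {v}. pres_cong X R `` {u @ v})"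
    by (intro SUP_cong HOL.refl)
  moreover have "pres_cong X R `` {u} \<noteq> {}" "pres_cong X R `` {v} \<noteq> {}"
    using assms by (auto intro: pres_cong.refl)
  ultimately show ?thesis by (simp add: presented_monoid_def)
qed

lemma presented_monoid_carrier:
  "carrier (presented_monoid X R) = (\<lambda>w. pres_cong X R `` {w}) ` lists X"
  by (auto simp: presented_monoid_def quotient_def)

lemma monoid_presented_monoid:
  assumes R: "R \<subseteq> lists X \<times> lists X"
  shows "monoid (presented_monoid X R)"
proof -
  have one: "\<one>\<^bsub>presented_monoid X R\<^esub> = pres_cong X R `` {[]}"
    by (simp add: presented_monoid_def)
  show ?thesis
    by (rule monoidI)
      (auto simp: presented_monoid_carrier one presented_monoid_mult[OF R] simp del: Image_singleton_iff)
qed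

section \<open>The monoids \<open>M n\<close>: classes of words and their weight\<close>

lemma M_rels_lists: "M_rels n \<subseteq> lists {1..n} \<times> lists {1..n}"
  by (auto simp: M_rels_def)

definition M_class :: "nat \<Rightarrow> nat list \<Rightarrow> nat list set" where
  "M_class n w = pres_cong {1..n} (M_rels n) `` {w}"

lemma M_carrier: "carrier (M n) = M_class n ` lists {1..n}"
  by (simp add: M_def presented_monoid_carrier M_class_def)

lemma M_class_closed: "w \<in> lists {1..n} \<Longrightarrow> M_class n w \<in> carrier (M n)"
  by (simp add: M_carrier)

lemma M_one: "\<one>\<^bsub>M n\<^esub> = M_class n []"
  by (simp add: M_def presented_monoid_def M_class_def)

lemma M_mult: "u \<in> lists {1..n} \<Longrightarrow> v \<in> lists {1..n} \<Longrightarrow>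
    M_class n u \<otimes>\<^bsub>M n\<^esub> M_class n v = M_class n (u @ v)"
  unfolding M_class_def M_def by (rule presented_monoid_mult[OF M_rels_lists])

lemma monoid_M: "monoid (M n)"
  unfolding M_def by (rule monoid_presented_monoid[OF M_rels_lists])

lemma M_class_eq_iff:
  "u \<in> lists {1..n} \<Longrightarrow> v \<in> lists {1..n} \<Longrightarrow>
    M_class n u = M_class n v \<longleftrightarrow> (u, v) \<in> pres_cong {1..n} (M_rels n)"
  unfolding M_class_def by (rule eq_equiv_class_iff[OF equiv_pres_cong[OF M_rels_lists]])

text \<open>Each letter weighs its own value, and both sides of a defining relation weigh
  \<open>1 + n + i\<close>.\<close>

lemma pres_cong_sum_list:
  "(u, v) \<in> pres_cong {1..n} (M_rels n) \<Longrightarrow> sum_list u = sum_list v"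
  by (induction rule: pres_cong.induct) (auto simp: M_rels_def)

definition M_wt :: "nat \<Rightarrow> nat list set \<Rightarrow> nat" where
  "M_wt n X = sum_list (SOME w. w \<in> X)"

lemma M_wt_class:
  assumes "w \<in> lists {1..n}"
  shows "M_wt n (M_class n w) = sum_list w"
proof -
  have "w \<in> M_class n w" using assms by (auto simp: M_class_def intro: pres_cong.refl)
  then have "(SOME v. v \<in> M_class n w) \<in> M_class n w" by (rule someI)
  then show ?thesis unfolding M_wt_def M_class_def using pres_cong_sum_list by auto
qed

subsection \<open>Left cancellation and least common multiples\<close>

text \<open>The properties of \<open>M n\<close> from which the arithmetic of divisors is derived
  without words; the common multiple property, whose proof needs words, joins in
  \<open>rho_lcm_monoid\<close>.\<close>

locale rho_monoid = monoid G for G (structure) +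
  fixes n :: nat and r :: "nat \<Rightarrow> 'a" and wt :: "'a \<Rightarrow> nat"
  assumes n_pos: "1 \<le> n"
    and r_closed [simp, intro]: "i \<le> n \<Longrightarrow> r i \<in> carrier G"
    and r_0 [simp]: "r 0 = \<one>"
    and r_rel: "\<lbrakk>1 \<le> i; i < n\<rbrakk> \<Longrightarrow> r 1 \<otimes> (r n \<otimes> r i) = r (Suc i) \<otimes> r n"
    and wt_mult [simp]: "\<lbrakk>u \<in> carrier G; v \<in> carrier G\<rbrakk> \<Longrightarrow> wt (u \<otimes> v) = wt u + wt v"
    and wt_r [simp]: "i \<le> n \<Longrightarrow> wt (r i) = i"
    and generated: "\<lbrakk>z \<in> carrier G; z \<noteq> \<one>\<rbrakk> \<Longrightarrow>
          \<exists>a z'. 1 \<le> a \<and> a \<le> n \<and> z' \<in> carrier G \<and> z = r a \<otimes> z'"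
begin

abbreviation "y \<equiv> r n"
definition "x = r 1 \<otimes> r n"

lemma x_closed [simp, intro]: "x \<in> carrier G"
  using n_pos by (simp add: x_def)

text \<open>For \<open>i = 0\<close> this is the definition of \<open>x\<close>, as
  \<open>r 0 = \<one>\<close>; otherwise it is a defining relation.\<close>

lemma x_r: "i < n \<Longrightarrow> x \<otimes> r i = r (Suc i) \<otimes> y"
  using r_rel[of i] n_pos by (cases "i = 0") (simp_all add: m_assoc x_def)

lemma x_pow_r: "i + b \<le> n \<Longrightarrow> x [^] b \<otimes> r i = r (i + b) \<otimes> y [^] b"
proof (induction b arbitrary: i)
  case (Suc b)
  have "x [^] Suc b \<otimes> r i = x [^] b \<otimes> (x \<otimes> r i)"
    using Suc.prems by (simp add: m_assoc)
  also have "\<dots> = x [^] b \<otimes> r (Suc i) \<otimes> y"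
    using Suc.prems by (subst x_r) (simp_all add: m_assoc)
  also have "\<dots> = r (i + Suc b) \<otimes> y [^] Suc b"
    using Suc.prems Suc.IH[of "Suc i"] by (simp add: m_assoc)
  finally show ?case .
qed simp

lemma r_y_pow: "b \<le> a \<Longrightarrow> a \<le> n \<Longrightarrow> r a \<otimes> y [^] b = x [^] b \<otimes> r (a - b)"
  using x_pow_r[of "a - b" b] by simp

lemma x_pow_eq: "b \<le> n \<Longrightarrow> x [^] b = r b \<otimes> y [^] b"
  using x_pow_r[of 0 b] by simp

text \<open>Both sides equal \<open>x^b r (a - b)\<close>, since \<open>x^b = r b y^b\<close>. This
  is the common multiple of \<open>r a\<close> and \<open>r b\<close> behind
  \<open>lcm_form\<close>.\<close>

lemma r_y_pow': "b \<le> a \<Longrightarrow> a \<le> n \<Longrightarrow> r a \<otimes> y [^] b = r b \<otimes> (y [^] b \<otimes> r (a - b))"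
  using r_y_pow[of b a] x_pow_eq[of b] by (simp add: m_assoc)

lemma r_y_pow_mult: "b \<le> a \<Longrightarrow> a \<le> n \<Longrightarrow> w \<in> carrier G \<Longrightarrow>
    r a \<otimes> (y [^] b \<otimes> w) = r b \<otimes> (y [^] b \<otimes> (r (a - b) \<otimes> w))"
  using arg_cong[OF r_y_pow'[of b a], of "\<lambda>t. t \<otimes> w"] by (simp add: m_assoc)

lemma pow_Suc_mult: "u \<in> carrier G \<Longrightarrow> w \<in> carrier G \<Longrightarrow> u [^] Suc b \<otimes> w = u \<otimes> (u [^] b \<otimes> w)"
  unfolding nat_pow_Suc2 by (simp add: m_assoc)

text \<open>The shape that every equation \<open>\<rho>\<^sub>a u = \<rho>\<^sub>b v\<close> turns out to have.\<close>

definition lcm_form :: "nat \<Rightarrow> 'a \<Rightarrow> nat \<Rightarrow> 'a \<Rightarrow> bool" where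
  "lcm_form a u b v \<longleftrightarrow> a = b \<and> u = v
    \<or> b < a \<and> (\<exists>w\<in>carrier G. u = y [^] b \<otimes> w \<and> v = y [^] b \<otimes> (r (a - b) \<otimes> w))
    \<or> a < b \<and> (\<exists>w\<in>carrier G. v = y [^] a \<otimes> w \<and> u = y [^] a \<otimes> (r (b - a) \<otimes> w))"

text \<open>Here \<open>a + wt u\<close> is the weight of \<open>r a \<otimes> u\<close>; the bound
  \<open>N\<close> makes the property usable as hypothesis of an induction on the weight. The case
  \<open>a = b\<close> is cancellation of a generator.\<close>

definition lcm_below :: "nat \<Rightarrow> bool" where
  "lcm_below N \<longleftrightarrow> (\<forall>a b u v. 1 \<le> a \<and> a \<le> n \<and> 1 \<le> b \<and> b \<le> n \<and> u \<in> carrier G \<and> v \<in> carrier G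
     \<and> r a \<otimes> u = r b \<otimes> v \<and> a + wt u < N \<longrightarrow> lcm_form a u b v)"

lemma lcm_belowD:
  "\<lbrakk>lcm_below N; 1 \<le> a; a \<le> n; 1 \<le> b; b \<le> n; u \<in> carrier G; v \<in> carrier G;
    r a \<otimes> u = r b \<otimes> v; a + wt u < N\<rbrakk> \<Longrightarrow> lcm_form a u b v"
  unfolding lcm_below_def by blast

lemma lcm_form_same: "lcm_form a u a v \<longleftrightarrow> u = v"
  by (auto simp: lcm_form_def)

lemma lcm_below_cancel:
  "\<lbrakk>lcm_below N; u \<in> carrier G; v \<in> carrier G; y \<otimes> u = y \<otimes> v; n + wt u < N\<rbrakk> \<Longrightarrow> u = v"
  using lcm_belowD[of N n n u v] n_pos by (simp add: lcm_form_same)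

lemma lcm_form_eq:
  assumes "lcm_form a u b v" "a \<le> n" "b \<le> n"
  shows "r a \<otimes> u = r b \<otimes> v"
  using assms(1) unfolding lcm_form_def
  by (elim disjE conjE bexE) (simp_all add: assms r_y_pow_mult[of b a] r_y_pow_mult[of a b])

text \<open>Follows one relation at the front, from \<open>r 1 y r (j - 1) w\<close> to
  \<open>r j y w\<close>. Removing \<open>r 1 y\<close> leaves
  \<open>r (j - 1) w = r (a - 1) u'\<close> of smaller weight. Its form, multiplied by
  \<open>y\<close>, is the one wanted, because the difference of the indices is unchanged.\<close>

lemma lcm_form_to_larger:
  assumes N: "lcm_below (a + wt u)" and a: "1 \<le> a" "a \<le> n" and j: "1 < j" "j \<le> n"
    and u: "u \<in> carrier G" and w: "w \<in> carrier G"
    and f: "lcm_form a u 1 (y \<otimes> (r (j - 1) \<otimes> w))"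
  shows "lcm_form a u j (y \<otimes> w)"
proof (cases "a = 1")
  case True
  then have "u = y \<otimes> (r (j - 1) \<otimes> w)" using f lcm_form_same by simp
  with True j w show ?thesis unfolding lcm_form_def by auto
next
  case False
  with f a obtain u' where u': "u' \<in> carrier G" "u = y \<otimes> u'"
    and "y \<otimes> (r (j - 1) \<otimes> w) = y \<otimes> (r (a - 1) \<otimes> u')"
    unfolding lcm_form_def by auto
  moreover have "wt (r a \<otimes> u) = wt (r 1 \<otimes> (y \<otimes> (r (j - 1) \<otimes> w)))"
    using lcm_form_eq[OF f] a j by simp
  \<comment> \<open>Cancelling \<open>y\<close> in front of \<open>r (j - 1) \<otimes> w\<close>
    takes place at weight \<open>n + (j - 1 + wt w)\<close>, exactly one below the bound.\<close>
  then have wt: "a + wt u = 1 + (n + (j - 1 + wt w))" using a j u w by simp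
  ultimately have eq: "r (j - 1) \<otimes> w = r (a - 1) \<otimes> u'"
    using lcm_below_cancel[OF N] a j w by simp
  then have "lcm_form (j - 1) w (a - 1) u'"
    using a j w u' wt False by (intro lcm_belowD[OF N]) auto
  then consider "a = j" "w = u'"
    | v where "a < j" "v \<in> carrier G" "w = y [^] (a - 1) \<otimes> v" "u' = y [^] (a - 1) \<otimes> (r (j - a) \<otimes> v)"
    | v where "j < a" "v \<in> carrier G" "u' = y [^] (j - 1) \<otimes> v" "w = y [^] (j - 1) \<otimes> (r (a - j) \<otimes> v)"
    unfolding lcm_form_def using a j False by auto
  then show ?thesis
  proof cases
    case 1 then show ?thesis using u' lcm_form_same by simp
  next
    case 2
    have "y \<otimes> w = y [^] a \<otimes> v" "u = y [^] a \<otimes> (r (j - a) \<otimes> v)"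
      using 2 a u' j pow_Suc_mult[of y _ "a - 1"] by auto
    with 2 show ?thesis unfolding lcm_form_def by auto
  next
    case 3
    have "u = y [^] j \<otimes> v" "y \<otimes> w = y [^] j \<otimes> (r (a - j) \<otimes> v)"
      using 3 a u' j pow_Suc_mult[of y _ "j - 1"] by auto
    with 3 show ?thesis unfolding lcm_form_def by auto
  qed
qed

text \<open>The same relation followed backwards: after cancelling one \<open>y\<close>,
  \<open>r_y_pow_mult\<close> with both indices lowered by one turns the form for \<open>j\<close>
  into the form for 1.\<close>

lemma lcm_form_to_one:
  assumes N: "lcm_below (a + wt u)" and a: "1 \<le> a" "a \<le> n" and j: "1 < j" "j \<le> n"
    and u: "u \<in> carrier G" and w: "w \<in> carrier G"
    and f: "lcm_form a u j (y \<otimes> w)"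
  shows "lcm_form a u 1 (y \<otimes> (r (j - 1) \<otimes> w))"
proof -
  have "wt (r a \<otimes> u) = wt (r j \<otimes> (y \<otimes> w))"
    using lcm_form_eq[OF f] a j by simp
  then have wt: "a + wt u = j + (n + wt w)" using a j u w by simp
  have cancel: "w = v" if "y \<otimes> w = y \<otimes> v" "v \<in> carrier G" for v
    using lcm_below_cancel[OF N w that(2,1)] wt j by simp
  from f consider "a = j" "u = y \<otimes> w"
    | v where "a < j" "v \<in> carrier G" "y \<otimes> w = y [^] a \<otimes> v" "u = y [^] a \<otimes> (r (j - a) \<otimes> v)"
    | v where "j < a" "v \<in> carrier G" "u = y [^] j \<otimes> v" "y \<otimes> w = y [^] j \<otimes> (r (a - j) \<otimes> v)"
    unfolding lcm_form_def by auto
  then show ?thesis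
  proof cases
    case 1 then show ?thesis using j w unfolding lcm_form_def by auto
  next
    case 2
    obtain a' where a': "a = Suc a'" using a by (cases a) auto
    have w': "w = y [^] a' \<otimes> v" using 2 a' j pow_Suc_mult[of y _ "a'"] by (intro cancel) auto
    have u': "u = y \<otimes> (y [^] a' \<otimes> (r (j - a) \<otimes> v))"
      using 2 a' j pow_Suc_mult[of y _ a'] by simp
    have c: "r (j - 1) \<otimes> w = r a' \<otimes> (y [^] a' \<otimes> (r (j - a) \<otimes> v))"
      using r_y_pow_mult[of a' "j - 1" v] 2 a' j w' by simp
    show ?thesis
    \<comment> \<open>For \<open>a = 1\<close> the goal falls under the diagonal case of
      \<open>lcm_form\<close>.\<close>
    proof (cases "a = 1")
      case True then show ?thesis using a' c u' 2 j by (simp add: lcm_form_same)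
    next
      case False
      have "y [^] a' \<otimes> (r (j - a) \<otimes> v) \<in> carrier G" using 2 j by simp
      then show ?thesis using False a a' u' c 2 j unfolding lcm_form_def
        by (auto intro!: bexI[of _ "y [^] a' \<otimes> (r (j - a) \<otimes> v)"])
    qed
  next
    case 3
    obtain j' where j': "j = Suc j'" using j by (cases j) auto
    have w': "w = y [^] j' \<otimes> (r (a - j) \<otimes> v)"
      using 3 j' a pow_Suc_mult[of y _ j'] by (intro cancel) auto
    have u': "u = y \<otimes> (y [^] j' \<otimes> v)" using 3 j' pow_Suc_mult[of y _ j'] by simp
    have c: "r (a - 1) \<otimes> (y [^] j' \<otimes> v) = r j' \<otimes> w"
      using r_y_pow_mult[of j' "a - 1" v] 3 j' a w' by simp
    show ?thesis using 3 u' c j' a j unfolding lcm_form_def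
      by (auto intro!: bexI[of _ "y [^] j' \<otimes> v"])
  qed
qed

end

text \<open>The convention \<open>\<rho>\<^sub>0 = 1\<close> makes \<open>x\<^sup>b \<rho>\<^sub>i = \<rho>\<^bsub>i+b\<^esub> \<rho>\<^sub>n\<^sup>b\<close> meaningful for \<open>i = 0\<close> too.\<close>

definition rho0 :: "nat \<Rightarrow> nat \<Rightarrow> nat list set" where
  "rho0 n i = (if i = 0 then \<one>\<^bsub>M n\<^esub> else rho n i)"

lemma rho0_class: "1 \<le> i \<Longrightarrow> rho0 n i = M_class n [i]"
  by (simp add: rho0_def rho_def M_class_def)

lemma rho_monoid_M:
  assumes "1 \<le> n"
  shows "rho_monoid (M n) n (rho0 n) (M_wt n)"
proof -
  interpret monoid "M n" by (rule monoid_M)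
  show ?thesis
  proof
    show "1 \<le> n" by fact
    show "rho0 n i \<in> carrier (M n)" if "i \<le> n" for i
      using that by (cases "i = 0") (auto simp: rho0_class rho0_def[of n 0] intro!: M_class_closed)
    show "rho0 n 0 = \<one>\<^bsub>M n\<^esub>" by (simp add: rho0_def)
    show "rho0 n 1 \<otimes>\<^bsub>M n\<^esub> (rho0 n n \<otimes>\<^bsub>M n\<^esub> rho0 n i) = rho0 n (Suc i) \<otimes>\<^bsub>M n\<^esub> rho0 n n"
      if "1 \<le> i" "i < n" for i
    proof -
      have "([1, n, i], [i + 1, n]) \<in> pres_cong {1..n} (M_rels n)"
        using that by (intro pres_cong.rel) (auto simp: M_rels_def)
      then show ?thesis using that by (simp add: rho0_class M_mult M_class_eq_iff)
    qed
    show "M_wt n (u \<otimes>\<^bsub>M n\<^esub> v) = M_wt n u + M_wt n v"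
      if "u \<in> carrier (M n)" "v \<in> carrier (M n)" for u v
      using that by (auto simp: M_carrier M_mult M_wt_class)
    show "M_wt n (rho0 n i) = i" if "i \<le> n" for i
      using that by (cases "i = 0") (simp_all add: rho0_class M_wt_class M_one rho0_def[of n 0])
    show "\<exists>a z'. 1 \<le> a \<and> a \<le> n \<and> z' \<in> carrier (M n) \<and> z = rho0 n a \<otimes>\<^bsub>M n\<^esub> z'"
      if z: "z \<in> carrier (M n)" and "z \<noteq> \<one>\<^bsub>M n\<^esub>" for z
    proof -
      from z obtain w where w: "w \<in> lists {1..n}" "z = M_class n w" by (auto simp: M_carrier)
      with \<open>z \<noteq> \<one>\<^bsub>M n\<^esub>\<close> obtain a v where "w = a # v" by (cases w) (auto simp: M_one)
      with w show ?thesis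
        by (intro exI[of _ a] exI[of _ "M_class n v"])
          (auto simp: rho0_class M_mult M_class_closed)
    qed
  qed
qed

text \<open>One side of each relation begins with 1, the other with \<open>i + 1 > 1\<close>. So a
  step either stays in the tail or acts at the front and exchanges a first letter 1 with a larger
  one.\<close>

lemma word_step_Cons:
  assumes "(c # w, b # v) \<in> word_step {1..n} (M_rels n)"
  obtains "c = b" "w \<in> lists {1..n}" "v \<in> lists {1..n}" "M_class n w = M_class n v"
  | w' where "c = 1" "1 < b" "b \<le> n" "w' \<in> lists {1..n}" "w = n # (b - 1) # w'" "v = n # w'"
  | w' where "b = 1" "1 < c" "c \<le> n" "w' \<in> lists {1..n}" "v = n # (c - 1) # w'" "w = n # w'"
  using assms
proof cases
  case (1 l l' p s)
  show ?thesis
  proof (cases p)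
    case Nil
    with 1 that(2,3) show ?thesis by (auto simp: M_rels_def)
  next
    case (Cons c' p')
    have "(l, l') \<in> pres_cong {1..n} (M_rels n)"
      using 1 by (auto intro: pres_cong.rel pres_cong.sym)
    then have "(p' @ l @ s, p' @ l' @ s) \<in> pres_cong {1..n} (M_rels n)"
      using 1 Cons by (intro pres_cong.mult pres_cong.refl) auto
    moreover have "w = p' @ l @ s" "v = p' @ l' @ s" and cb: "c = b" using 1 Cons by auto
    ultimately have wv: "(w, v) \<in> pres_cong {1..n} (M_rels n)" by simp
    note l = pres_cong_lists[OF M_rels_lists wv]
    show ?thesis
      by (rule that(1)[OF cb conjunct1[OF l] conjunct2[OF l]])
        (use wv M_class_eq_iff[OF conjunct1[OF l] conjunct2[OF l]] in simp)
  qed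
qed

text \<open>Garside's double induction: the outer one on the weight bound, the inner one on the
  number of relations applied between \<open>a # u\<close> and \<open>b # v\<close>. A relation in
  the tail keeps the class of the tail; one at the front is handled by
  \<open>lcm_form_to_larger\<close> or \<open>lcm_form_to_one\<close>.\<close>

lemma M_lcm_below:
  assumes "1 \<le> n"
  shows "rho_monoid.lcm_below (M n) n (rho0 n) (M_wt n) N"
proof (induction N rule: less_induct)
  case (less N)
  interpret rho_monoid "M n" n "rho0 n" "M_wt n" by (rule rho_monoid_M[OF assms])
  have *: "lcm_form a (M_class n u) b (M_class n v)"
    if "(a # u, b # v) \<in> (word_step {1..n} (M_rels n))\<^sup>*" "a # u \<in> lists {1..n}"
      "sum_list (a # u) < N" for a u b v
    using that(1)
  proof (induction "b # v" arbitrary: b v rule: rtrancl_induct)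
    case base
    then show ?case by (simp add: lcm_form_same)
  next
    case (step w')
    \<comment> \<open>Both sides of every relation are nonempty, so the intermediate word has a
      first letter.\<close>
    from step.hyps(2) have "w' \<noteq> []" by cases (auto simp: M_rels_def)
    then obtain c w where w': "w' = c # w" by (cases w') auto
    have IH: "lcm_form a (M_class n u) c (M_class n w)" using step.hyps(3) w' by blast
    have a: "1 \<le> a" "a \<le> n" and u: "u \<in> lists {1..n}" using that(2) by auto
    have N: "lcm_below (a + M_wt n (M_class n u))"
      using less.IH that(3) u by (simp add: M_wt_class)
    from step.hyps(2) show ?case unfolding w'
    proof (cases rule: word_step_Cons)
      case 1
      then show ?thesis using IH by simp
    next
      case (2 v')
      have "1 \<le> b - 1" "[b - 1] \<in> lists {1..n}" "[n] \<in> lists {1..n}" using 2 by auto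
      then have eq: "rho0 n n \<otimes>\<^bsub>M n\<^esub> (rho0 n (b - 1) \<otimes>\<^bsub>M n\<^esub> M_class n v') = M_class n w"
        "rho0 n n \<otimes>\<^bsub>M n\<^esub> M_class n v' = M_class n v"
        using 2 assms by (simp_all add: rho0_class M_mult)
      show ?thesis
        using lcm_form_to_larger[OF N a 2(2,3) M_class_closed[OF u] M_class_closed[OF 2(4)]] IH
        unfolding eq 2(1) by blast
    next
      case (3 v')
      have "1 \<le> c - 1" "[c - 1] \<in> lists {1..n}" "[n] \<in> lists {1..n}" using 3 by auto
      then have eq: "rho0 n n \<otimes>\<^bsub>M n\<^esub> (rho0 n (c - 1) \<otimes>\<^bsub>M n\<^esub> M_class n v') = M_class n v"
        "rho0 n n \<otimes>\<^bsub>M n\<^esub> M_class n v' = M_class n w"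
        using 3 assms by (simp_all add: rho0_class M_mult)
      show ?thesis
        using lcm_form_to_one[OF N a 3(2,3) M_class_closed[OF u] M_class_closed[OF 3(4)]] IH
        unfolding eq 3(1) by blast
    qed
  qed
  show ?case
    unfolding lcm_below_def
  proof (intro allI impI, elim conjE)
    fix a b U V
    assume ab: "1 \<le> a" "a \<le> n" "1 \<le> b" "b \<le> n"
      and UV: "U \<in> carrier (M n)" "V \<in> carrier (M n)"
      and eq: "rho0 n a \<otimes>\<^bsub>M n\<^esub> U = rho0 n b \<otimes>\<^bsub>M n\<^esub> V" and wt: "a + M_wt n U < N"
    from UV obtain u v where uv: "u \<in> lists {1..n}" "U = M_class n u" "v \<in> lists {1..n}" "V = M_class n v"
      by (auto simp: M_carrier)
    have "M_class n (a # u) = M_class n (b # v)" using eq uv ab by (simp add: rho0_class M_mult)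
    then have "(a # u, b # v) \<in> pres_cong {1..n} (M_rels n)"
      using M_class_eq_iff[of "a # u" n "b # v"] uv ab by simp
    then show "lcm_form a U b V"
      using *[of a u b v] pres_cong_word_steps[OF M_rels_lists] uv ab wt by (simp add: M_wt_class)
  qed
qed

subsection \<open>Divisors of powers of \<open>x\<close>\<close>

locale rho_lcm_monoid = rho_monoid +
  assumes lcm_below: "lcm_below N"
begin

abbreviation dvd_left (infix \<open>\<preceq>\<close> 50) where "a \<preceq> b \<equiv> a divides b"

lemma r_lcm_form:
  "\<lbrakk>1 \<le> a; a \<le> n; 1 \<le> b; b \<le> n; u \<in> carrier G; v \<in> carrier G; r a \<otimes> u = r b \<otimes> v\<rbrakk>
    \<Longrightarrow> lcm_form a u b v"
  by (rule lcm_belowD[OF lcm_below]) auto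

lemma r_cancel:
  "\<lbrakk>a \<le> n; u \<in> carrier G; v \<in> carrier G; r a \<otimes> u = r a \<otimes> v\<rbrakk> \<Longrightarrow> u = v"
  using r_lcm_form[of a a u v] lcm_form_same by (cases "a = 0") auto

lemma wt_one [simp]: "wt \<one> = 0"
  using wt_r[of 0] by simp

lemma wt_eq_0: "z \<in> carrier G \<Longrightarrow> wt z = 0 \<Longrightarrow> z = \<one>"
  using generated[of z] by fastforce

lemma wt_pow: "z \<in> carrier G \<Longrightarrow> wt (z [^] (k::nat)) = k * wt z"
  by (induction k) auto

text \<open>Generators cancel by the diagonal case of \<open>lcm_form\<close>; a general
  \<open>z\<close> is stripped one generator at a time.\<close>

lemma l_cancel:
  assumes "z \<in> carrier G" "u \<in> carrier G" "v \<in> carrier G" "z \<otimes> u = z \<otimes> v"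
  shows "u = v"
  using assms(1,4)
proof (induction "wt z" arbitrary: z rule: less_induct)
  case less
  show ?case
  proof (cases "z = \<one>")
    case False
    then obtain a z' where z: "1 \<le> a" "a \<le> n" "z' \<in> carrier G" "z = r a \<otimes> z'"
      using generated[OF less.prems(1)] by blast
    then have "r a \<otimes> (z' \<otimes> u) = r a \<otimes> (z' \<otimes> v)" using less.prems assms(2,3) by (simp add: m_assoc)
    then have "z' \<otimes> u = z' \<otimes> v" using r_cancel[of a] z assms(2,3) by simp
    then show ?thesis using less.hyps[of z'] z by simp
  qed (use less.prems assms(2,3) in simp)
qed

lemma dvd_cancel:
  assumes "z \<in> carrier G" "u \<in> carrier G" "v \<in> carrier G"
  shows "z \<otimes> u \<preceq> z \<otimes> v \<longleftrightarrow> u \<preceq> v"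
proof
  assume "z \<otimes> u \<preceq> z \<otimes> v"
  then obtain c where c: "c \<in> carrier G" "z \<otimes> v = z \<otimes> u \<otimes> c" unfolding factor_def by blast
  then have "v = u \<otimes> c" using l_cancel[of z v "u \<otimes> c"] assms by (simp add: m_assoc)
  with c show "u \<preceq> v" unfolding factor_def by blast
qed (use assms in \<open>auto simp: factor_def m_assoc\<close>)

lemma dvd_refl: "z \<in> carrier G \<Longrightarrow> z \<preceq> z"
  unfolding factor_def by (auto intro!: bexI[of _ \<one>])

lemma dvd_mult: "\<lbrakk>w \<in> carrier G; c \<in> carrier G; z \<in> carrier G; z \<preceq> w\<rbrakk> \<Longrightarrow> z \<preceq> w \<otimes> c"
  unfolding factor_def by (auto simp: m_assoc)

lemma dvd_mult_self: "z \<in> carrier G \<Longrightarrow> c \<in> carrier G \<Longrightarrow> z \<preceq> z \<otimes> c"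
  unfolding factor_def by blast

lemma mult_dvdD: "\<lbrakk>z \<in> carrier G; c \<in> carrier G; z \<otimes> c \<preceq> w\<rbrakk> \<Longrightarrow> z \<preceq> w"
  unfolding factor_def by (auto simp: m_assoc)

lemma one_dvd: "z \<in> carrier G \<Longrightarrow> \<one> \<preceq> z"
  unfolding factor_def by auto

lemma dvd_trans: "\<lbrakk>z \<preceq> w; w \<preceq> v; z \<in> carrier G\<rbrakk> \<Longrightarrow> z \<preceq> v"
  unfolding factor_def by (auto simp: m_assoc)

lemma dvd_wt_le: "\<lbrakk>z \<preceq> w; z \<in> carrier G\<rbrakk> \<Longrightarrow> wt z \<le> wt w"
  unfolding factor_def by auto

lemma dvd_antisym:
  assumes "z \<preceq> w" "w \<preceq> z" "z \<in> carrier G" "w \<in> carrier G"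
  shows "z = w"
proof -
  obtain c where c: "c \<in> carrier G" "w = z \<otimes> c" using assms(1) unfolding factor_def by blast
  then have "wt c = 0" using dvd_wt_le[OF assms(2,4)] assms(3) by simp
  then have "c = \<one>" using wt_eq_0 c by blast
  then show ?thesis using c assms(3) by simp
qed

lemma dvd_one: "z \<in> carrier G \<Longrightarrow> z \<preceq> \<one> \<Longrightarrow> z = \<one>"
  using dvd_antisym one_dvd by blast

lemma r_dvd_smaller:
  assumes "1 \<le> b" "b < a" "a \<le> n" "u \<in> carrier G" "r b \<preceq> r a \<otimes> u"
  shows "y [^] b \<preceq> u"
proof -
  obtain c where "c \<in> carrier G" "r a \<otimes> u = r b \<otimes> c" using assms(5) unfolding factor_def by blast
  then have "lcm_form a u b c" using assms by (intro r_lcm_form) auto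
  then show ?thesis using assms unfolding lcm_form_def factor_def by auto
qed

text \<open>The common multiple \<open>r b y^a = r a y^a r (b - a)\<close> is least, and
  \<open>r a\<close> cancels. For \<open>a = 0\<close>, outside the range of
  \<open>lcm_form\<close>, the claim is the assumption.\<close>

lemma r_dvd_larger:
  assumes "a < b" "b \<le> n" "u \<in> carrier G" "r b \<preceq> r a \<otimes> u"
  shows "y [^] a \<otimes> r (b - a) \<preceq> u"
proof (cases "a = 0")
  case False
  obtain c where "c \<in> carrier G" "r a \<otimes> u = r b \<otimes> c" using assms(4) unfolding factor_def by blast
  then have "lcm_form a u b c" using assms False by (intro r_lcm_form) auto
  then show ?thesis using assms unfolding lcm_form_def factor_def by (auto simp: m_assoc)
qed (use assms in simp)

text \<open>After cancelling \<open>y^k\<close> a positive power of \<open>y\<close> remains in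
  front.\<close>

lemma y_pow_dvd_y_pow:
  fixes k g :: nat
  assumes "k < g" "u \<in> carrier G" "w \<in> carrier G" "y [^] g \<otimes> w \<preceq> y [^] k \<otimes> u"
  shows "y \<preceq> u"
proof -
  have "y [^] g \<otimes> w = y [^] k \<otimes> (y [^] (g - k) \<otimes> w)"
    using assms by (simp add: m_assoc[symmetric] nat_pow_mult)
  then have "y [^] (g - k) \<otimes> w \<preceq> u" using assms dvd_cancel by simp
  moreover have "g - k = Suc (g - k - 1)" using assms(1) by simp
  then have "y [^] (g - k) \<otimes> w = y \<otimes> (y [^] (g - k - 1) \<otimes> w)"
    using pow_Suc_mult[of y w "g - k - 1"] assms(3) by (metis r_closed order_refl)
  ultimately show ?thesis using mult_dvdD[of y "y [^] (g - k - 1) \<otimes> w"] assms by simp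
qed

text \<open>Otherwise the least common multiple of \<open>r g\<close> and \<open>y\<close> would put
  \<open>y^g\<close> in front of \<open>y^k u\<close>, and \<open>g > k\<close> would make
  \<open>y\<close> divide \<open>u\<close>.\<close>

lemma y_not_dvd_r_mult:
  assumes "k < g" "g < n" "u \<in> carrier G" "\<not> y \<preceq> u"
  shows "\<not> y \<preceq> r g \<otimes> (y [^] k \<otimes> u)"
proof
  assume "y \<preceq> r g \<otimes> (y [^] k \<otimes> u)"
  then have "y [^] g \<otimes> r (n - g) \<preceq> y [^] k \<otimes> u"
    using assms r_dvd_larger[of g n "y [^] k \<otimes> u"] by simp
  then show False using y_pow_dvd_y_pow[of k g u "r (n - g)"] assms by simp
qed

text \<open>Splitting off \<open>y\<close> terminates because its weight \<open>n\<close> is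
  positive.\<close>

lemma y_exponent:
  assumes "z \<in> carrier G"
  shows "\<exists>f::nat. \<exists>z'\<in>carrier G. z = y [^] f \<otimes> z' \<and> \<not> y \<preceq> z'"
  using assms
proof (induction "wt z" arbitrary: z rule: less_induct)
  case less
  show ?case
  proof (cases "y \<preceq> z")
    case True
    then obtain t where t: "t \<in> carrier G" "z = y \<otimes> t" unfolding factor_def by blast
    then obtain f :: nat and z' where "z' \<in> carrier G" "t = y [^] f \<otimes> z'" "\<not> y \<preceq> z'"
      using less.hyps[of t] n_pos by auto
    then show ?thesis using t pow_Suc_mult[of y z' f] by (metis r_closed order_refl)
  next
    case False
    then show ?thesis using less.prems by (intro exI[of _ 0] bexI[of _ z]) auto
  qed
qed

lemma y_pow_Suc: "e \<le> n \<Longrightarrow> y [^] Suc e = x [^] e \<otimes> r (n - e)"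
  using r_y_pow[of e n] nat_pow_Suc2[of y e] by simp

lemma x_pow_dvd_y_pow: "e \<le> n \<Longrightarrow> x [^] e \<preceq> y [^] Suc e"
  by (subst y_pow_Suc) (auto intro!: dvd_mult_self)

lemma x_pow_add: "c \<le> n \<Longrightarrow> c \<le> k \<Longrightarrow> x [^] k = r c \<otimes> (y [^] c \<otimes> x [^] (k - c))"
  using x_pow_eq[of c] nat_pow_mult[of x c "k - c"] by (simp add: m_assoc)

text \<open>Because \<open>\<rho>\<^sub>c \<rho>\<^sub>n\<^sup>c \<rho>\<^bsub>g-c\<^esub> = \<rho>\<^sub>g \<rho>\<^sub>n\<^sup>c\<close>.\<close>

lemma r_not_dvd_strip:
  assumes "c < g" "g \<le> n" "t \<in> carrier G" "\<not> r g \<preceq> r c \<otimes> (y [^] c \<otimes> t)"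
  shows "\<not> r (g - c) \<preceq> t"
proof
  assume "r (g - c) \<preceq> t"
  then obtain s where s: "s \<in> carrier G" "t = r (g - c) \<otimes> s" unfolding factor_def by blast
  then have "r c \<otimes> (y [^] c \<otimes> t) = r g \<otimes> (y [^] c \<otimes> s)"
    using r_y_pow_mult[of c g s] assms by simp
  then show False using assms s dvd_mult_self[of "r g" "y [^] c \<otimes> s"] by simp
qed

text \<open>Let \<open>z = r c z'\<close>. Least common multiples force \<open>c < g\<close> and
  \<open>c \<le> k\<close>, and then \<open>r g y^k u = r c y^c v\<close>, so \<open>z'\<close>
  divides \<open>y^c v\<close>. As \<open>x^k = r c y^c x^(k - c)\<close>, it suffices that
  \<open>z'\<close> divides \<open>y^c x^(k - c)\<close>; the argument depends on the power
  \<open>y^f\<close> in front of \<open>z'\<close>.\<close>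

lemma dvd_x_pow_of_dvd_r_y_pow:
  assumes "1 \<le> g" "g \<le> n" "k < g" "u \<in> carrier G" "\<not> y \<preceq> u"
    "z \<in> carrier G" "z \<preceq> r g \<otimes> (y [^] k \<otimes> u)" "\<not> r g \<preceq> z"
  shows "z \<preceq> x [^] k"
  using assms
proof (induction "wt z" arbitrary: g k u z rule: less_induct)
  case less
  show ?case
  proof (cases "z = \<one>")
    case False
    then obtain c z' where c: "1 \<le> c" "c \<le> n" and z': "z' \<in> carrier G" and z: "z = r c \<otimes> z'"
      using generated less.prems(6) by blast
    have rc: "r c \<preceq> r g \<otimes> (y [^] k \<otimes> u)"
      using less.prems(7) mult_dvdD[of "r c" z'] c z z' by simp
    have "c \<noteq> g" using less.prems(8) z z' c dvd_mult_self by auto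
    moreover have "\<not> g < c"
    proof
      assume "g < c"
      then have "y [^] g \<otimes> r (c - g) \<preceq> y [^] k \<otimes> u"
        using r_dvd_larger[OF _ c(2) _ rc] less.prems by simp
      then show False using y_pow_dvd_y_pow[of k g u "r (c - g)"] less.prems c by simp
    qed
    ultimately have cg: "c < g" by simp
    have "y [^] c \<preceq> y [^] k \<otimes> u" using r_dvd_smaller[OF c(1) cg _ _ rc] less.prems by simp
    then have ck: "c \<le> k" using y_pow_dvd_y_pow[of k c u \<one>] less.prems by fastforce
    define v where "v = r (g - c) \<otimes> (y [^] (k - c) \<otimes> u)"
    have v: "v \<in> carrier G" using less.prems by (simp add: v_def)
    \<comment> \<open>Uses \<open>g - c < n\<close>, which holds because
      \<open>c \<ge> 1\<close>.\<close>
    have yv: "\<not> y \<preceq> v"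
      unfolding v_def using less.prems c cg ck by (intro y_not_dvd_r_mult) auto
    have "y [^] k \<otimes> u = y [^] c \<otimes> (y [^] (k - c) \<otimes> u)"
      using ck less.prems by (simp add: m_assoc[symmetric] nat_pow_mult)
    then have "r g \<otimes> (y [^] k \<otimes> u) = r c \<otimes> (y [^] c \<otimes> v)"
      using r_y_pow_mult[of c g "y [^] (k - c) \<otimes> u"] cg less.prems v_def by simp
    then have z'v: "z' \<preceq> y [^] c \<otimes> v" using less.prems(7) z dvd_cancel z' v c by simp
    obtain f :: nat and z'' where z'': "z'' \<in> carrier G" "z' = y [^] f \<otimes> z''" "\<not> y \<preceq> z''"
      using y_exponent[OF z'] by blast
    have "z' \<preceq> y [^] c \<otimes> x [^] (k - c)"
    \<comment> \<open>If \<open>f < c\<close>, then \<open>z''\<close> divides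
      \<open>y^(e + 1) v = r n y^e v\<close> and the induction hypothesis applies with
      \<open>g = n\<close>. Otherwise \<open>y^c\<close> cancels and it applies with
      \<open>g - c\<close> and \<open>k - c\<close>.\<close>
    proof (cases "f < c")
      case True
      obtain e where e: "c = f + Suc e" using True less_iff_Suc_add[of f c] by auto
      have "y [^] c = y [^] f \<otimes> y [^] Suc e" unfolding e by (rule nat_pow_mult[symmetric]) simp
      then have yc: "y [^] c \<otimes> v = y [^] f \<otimes> (y [^] Suc e \<otimes> v)" "y [^] c = y [^] f \<otimes> y [^] Suc e"
        using v by (simp_all add: m_assoc)
      have "z'' \<preceq> y [^] Suc e \<otimes> v" using z'v z'' v unfolding yc(1) by (simp add: dvd_cancel del: nat_pow_Suc)
      then have "z'' \<preceq> r n \<otimes> (y [^] e \<otimes> v)" using pow_Suc_mult[of y v e] v by simp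
      then have "z'' \<preceq> x [^] e"
        using less.hyps[of z'' n e v] z z'' c n_pos e v yv by simp
      then have "z'' \<preceq> y [^] Suc e"
        using dvd_trans[OF _ x_pow_dvd_y_pow z''(1)] e c by simp
      then have "z' \<preceq> y [^] c" using z'' yc dvd_cancel by simp
      then show ?thesis using dvd_mult z' by simp
    next
      case False
      define t where "t = y [^] (f - c) \<otimes> z''"
      have t: "t \<in> carrier G" "z' = y [^] c \<otimes> t"
        using z'' False by (simp_all add: t_def m_assoc[symmetric] nat_pow_mult)
      have "t \<preceq> r (g - c) \<otimes> (y [^] (k - c) \<otimes> u)" using z'v t v dvd_cancel v_def by simp
      moreover have "\<not> r (g - c) \<preceq> t"
        using r_not_dvd_strip[OF cg _ t(1)] less.prems z t by simp
      ultimately have "t \<preceq> x [^] (k - c)"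
        using less.hyps[of t "g - c" "k - c" u] less.prems cg ck c z t by simp
      then show ?thesis using t dvd_cancel by simp
    qed
    then show ?thesis using z z' c ck x_pow_add[of c k] dvd_cancel by simp
  qed (simp add: one_dvd)
qed

text \<open>Since \<open>x^(k + 1) = r 1 y x^k\<close>, the least common multiple of
  \<open>r 1\<close> and \<open>r j\<close> reduces the claim to \<open>r (j - 1)\<close> and
  \<open>x^k\<close>.\<close>

lemma r_dvd_x_pow: "\<lbrakk>1 \<le> j; j \<le> n; r j \<preceq> x [^] k\<rbrakk> \<Longrightarrow> j \<le> k"
proof (induction k arbitrary: j)
  case 0
  then show ?case using dvd_wt_le[of "r j" \<one>] by simp
next
  case (Suc k)
  show ?case
  proof (cases "j = 1")
    case False
    have "x [^] Suc k = r 1 \<otimes> (y \<otimes> x [^] k)"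
      using nat_pow_Suc2[of x k] n_pos by (simp add: m_assoc x_def)
    then have "y [^] (1::nat) \<otimes> r (j - 1) \<preceq> y \<otimes> x [^] k"
      using Suc.prems False by (intro r_dvd_larger) auto
    then have "r (j - 1) \<preceq> x [^] k" using dvd_cancel[of y "r (j - 1)" "x [^] k"] Suc.prems by simp
    then have "j - 1 \<le> k" using Suc.IH[of "j - 1"] Suc.prems False by linarith
    then show ?thesis by simp
  qed simp
qed

lemma y_not_dvd_x_pow: "k < n \<Longrightarrow> \<not> y \<preceq> x [^] k"
  using r_dvd_x_pow[of n k] n_pos by auto

text \<open>As \<open>x^g = r g y^g\<close>, this is the borderline \<open>k = g\<close> excluded
  from \<open>dvd_x_pow_of_dvd_r_y_pow\<close>. The same descent works with
  \<open>v = x^(g - c)\<close>, which \<open>y\<close> does not divide because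
  \<open>g - c < n\<close>.\<close>

lemma dvd_x_pow_pred:
  assumes "1 \<le> g" "g \<le> n" "z \<in> carrier G" "z \<preceq> x [^] g" "\<not> r g \<preceq> z"
  shows "z \<preceq> x [^] (g - 1)"
  using assms
proof (induction "wt z" arbitrary: g z rule: less_induct)
  case less
  show ?case
  proof (cases "z = \<one>")
    case False
    then obtain c z' where c: "1 \<le> c" "c \<le> n" and z': "z' \<in> carrier G" and z: "z = r c \<otimes> z'"
      using generated less.prems(3) by blast
    have "r c \<preceq> x [^] g"
      using less.prems(4) mult_dvdD[of "r c" z'] c z z' by simp
    then have "c \<le> g" using r_dvd_x_pow c by blast
    moreover have "c \<noteq> g" using less.prems(5) z z' c dvd_mult_self by auto
    ultimately have cg: "c < g" by simp
    define v where "v = x [^] (g - c)"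
    have v: "v \<in> carrier G" "\<not> y \<preceq> v"
      using y_not_dvd_x_pow c less.prems by (auto simp: v_def)
    have z'v: "z' \<preceq> y [^] c \<otimes> v"
      using less.prems(4) z dvd_cancel z' v c x_pow_add[of c g] cg by (simp add: v_def)
    obtain f :: nat and z'' where z'': "z'' \<in> carrier G" "z' = y [^] f \<otimes> z''" "\<not> y \<preceq> z''"
      using y_exponent[OF z'] by blast
    have "z' \<preceq> y [^] c \<otimes> x [^] (g - 1 - c)"
    proof (cases "f < c")
      case True
      obtain e where e: "c = f + Suc e" using True less_iff_Suc_add[of f c] by auto
      have "y [^] c = y [^] f \<otimes> y [^] Suc e" unfolding e by (rule nat_pow_mult[symmetric]) simp
      then have yc: "y [^] c \<otimes> v = y [^] f \<otimes> (y [^] Suc e \<otimes> v)" "y [^] c = y [^] f \<otimes> y [^] Suc e"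
        using v by (simp_all add: m_assoc)
      have "z'' \<preceq> y [^] Suc e \<otimes> v" using z'v z'' v unfolding yc(1) by (simp add: dvd_cancel del: nat_pow_Suc)
      then have "z'' \<preceq> r n \<otimes> (y [^] e \<otimes> v)" using pow_Suc_mult[of y v e] v by simp
      then have "z'' \<preceq> x [^] e"
        using dvd_x_pow_of_dvd_r_y_pow[of n e v z''] z z'' c n_pos e v by simp
      then have "z'' \<preceq> y [^] Suc e"
        using dvd_trans[OF _ x_pow_dvd_y_pow z''(1)] e c by simp
      then have "z' \<preceq> y [^] c" using z'' yc dvd_cancel by simp
      then show ?thesis using dvd_mult z' by simp
    next
      case False
      define t where "t = y [^] (f - c) \<otimes> z''"
      have t: "t \<in> carrier G" "z' = y [^] c \<otimes> t"
        using z'' False by (simp_all add: t_def m_assoc[symmetric] nat_pow_mult)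
      have "t \<preceq> x [^] (g - c)" using z'v t v dvd_cancel v_def by simp
      moreover have "\<not> r (g - c) \<preceq> t"
        using r_not_dvd_strip[OF cg _ t(1)] less.prems z t by simp
      ultimately have "t \<preceq> x [^] (g - c - 1)"
        using less.hyps[of t "g - c"] less.prems cg c z t by simp
      then show ?thesis using t dvd_cancel by (simp add: diff_right_commute)
    qed
    then show ?thesis using z z' c cg x_pow_add[of c "g - 1"] dvd_cancel by simp
  qed (simp add: one_dvd)
qed

end

text \<open>The divisors of \<open>x\<^sup>m\<close> are split into pieces \<open>0, \<dots>, m + 1\<close>, piece \<open>i\<close> being a copy of the divisors
  of \<open>x ^ level m i\<close>. For \<open>i < j\<close>, an element \<open>z\<close> of piece \<open>i\<close> lies below some (equivalently,
  every) element of piece \<open>j\<close> iff \<open>z\<close> divides \<open>x ^ bound m i j\<close>. The last piece is \<open>{x\<^sup>m}\<close>, for which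
  \<open>level m (m + 1) = 0\<close> by truncated subtraction.\<close>

definition level :: "nat \<Rightarrow> nat \<Rightarrow> nat" where
  "level m i = (if i = 0 then m - 1 else m - i)"

definition bound :: "nat \<Rightarrow> nat \<Rightarrow> nat \<Rightarrow> nat" where
  "bound m i j = (if i = 0 then min (j - 1) (m - 1) else j - i - 1)"

section \<open>Decomposition of the divisors of \<open>x^m\<close> into pieces\<close>

context rho_lcm_monoid
begin

definition initial :: "nat \<Rightarrow> 'a set" where
  "initial k = {z \<in> carrier G. z \<preceq> x [^] k}"

text \<open>Piece 0 collects the divisors of \<open>x^m\<close> not divisible by \<open>r m\<close>.
  In the others the exponent is \<open>i - 1\<close> because \<open>r m\<close> counts as the first
  factor: for \<open>m = n\<close> the value is \<open>y^i z\<close>.\<close>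

definition piece :: "nat \<Rightarrow> nat \<Rightarrow> 'a \<Rightarrow> 'a" where
  "piece m i z = (if i = 0 then z else r m \<otimes> (y [^] (i - 1) \<otimes> z))"

lemma initial_closed: "z \<in> initial k \<Longrightarrow> z \<in> carrier G"
  by (simp add: initial_def)

lemma x_pow_dvd_x_pow: "(j::nat) \<le> k \<Longrightarrow> x [^] j \<preceq> x [^] k"
  using dvd_mult_self[of "x [^] j" "x [^] (k - j)"] by (simp add: nat_pow_mult)

lemma x_pow_initial: "j \<le> k \<Longrightarrow> x [^] j \<in> initial k"
  by (simp add: initial_def x_pow_dvd_x_pow)

lemma initial_0: "initial 0 = {\<one>}"
  unfolding initial_def nat_pow_0 by (blast intro: dvd_one dvd_refl)

lemma r_not_dvd_initial: "z \<in> initial k \<Longrightarrow> k < j \<Longrightarrow> j \<le> n \<Longrightarrow> \<not> r j \<preceq> z"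
  using r_dvd_x_pow[of j k] dvd_trans[of "r j" z "x [^] k"] by (force simp: initial_def)

lemma piece_closed: "m \<le> n \<Longrightarrow> z \<in> carrier G \<Longrightarrow> piece m i z \<in> carrier G"
  by (simp add: piece_def)

text \<open>For \<open>0 < i < j\<close> the factor \<open>r m y^(i - 1)\<close> cancels and
  \<open>dvd_x_pow_of_dvd_r_y_pow\<close> applies with \<open>g = n\<close>; for
  \<open>i = 0 < j \<le> m\<close> it applies with \<open>g = m\<close>. A comparison with
  \<open>j < i\<close> would make \<open>r m\<close> or \<open>y\<close> divide
  \<open>w\<close>.\<close>

lemma piece_dvd_iff:
  assumes m: "1 \<le> m" "m \<le> n" and ij: "i \<le> Suc m" "j \<le> Suc m"
    and z: "z \<in> initial (level m i)" and w: "w \<in> initial (level m j)"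
  shows "piece m i z \<preceq> piece m j w \<longleftrightarrow> i = j \<and> z \<preceq> w \<or> i < j \<and> z \<preceq> x [^] bound m i j"
proof -
  have zw [simp]: "z \<in> carrier G" "w \<in> carrier G" using z w by (simp_all add: initial_def)
  have yw: "\<not> y \<preceq> w" if "0 < j"
    using r_not_dvd_initial[OF w] that m by (simp add: level_def)
  consider "i = 0" "j = 0" | "i = 0" "1 \<le> j" "j \<le> m" | "i = 0" "j = Suc m" | "0 < i" "j = 0"
    | "0 < i" "i = j" | "0 < i" "i < j" | "0 < j" "j < i"
    using ij by linarith
  then show ?thesis
  proof cases
    case 1
    then show ?thesis by (simp add: piece_def)
  next
    case 2
    have "\<not> r m \<preceq> z" using r_not_dvd_initial[OF z] 2 m by (simp add: level_def)
    then have "z \<preceq> x [^] (j - 1)" if "z \<preceq> r m \<otimes> (y [^] (j - 1) \<otimes> w)"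
      using dvd_x_pow_of_dvd_r_y_pow[of m "j - 1" w z] that 2 m yw by simp
    moreover have "z \<preceq> r m \<otimes> (y [^] (j - 1) \<otimes> w)" if "z \<preceq> x [^] (j - 1)"
    proof -
      have "r m \<otimes> (y [^] (j - 1) \<otimes> w) = x [^] (j - 1) \<otimes> (r (m - (j - 1)) \<otimes> w)"
        using r_y_pow[of "j - 1" m] 2 m by (simp add: m_assoc[symmetric])
      then show ?thesis using that m dvd_mult[of "x [^] (j - 1)"] by simp
    qed
    ultimately show ?thesis using 2 m by (auto simp: piece_def bound_def min_def)
  next
    \<comment> \<open>Here \<open>j - 1 = m\<close> is too large for
      \<open>dvd_x_pow_of_dvd_r_y_pow\<close>, but both sides are true: the bound is
      \<open>m - 1\<close>, the level of piece 0.\<close>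
    case 3
    then have "w = \<one>" using w initial_0 by (simp add: level_def)
    then have "piece m j w = x [^] m" using 3 m x_pow_eq[of m] by (simp add: piece_def)
    moreover have "z \<preceq> x [^] (m - 1)" using z 3 by (simp add: level_def initial_def)
    moreover from this have "z \<preceq> x [^] m"
      using dvd_trans[OF _ x_pow_dvd_x_pow[of "m - 1" m]] by simp
    ultimately show ?thesis using 3 m by (simp add: piece_def bound_def min_def)
  next
    case 4
    have "\<not> r m \<preceq> w" using r_not_dvd_initial[OF w] 4 m by (simp add: level_def)
    then have "\<not> piece m i z \<preceq> w" using mult_dvdD[of "r m" "y [^] (i - 1) \<otimes> z" w] 4 m
      by (auto simp: piece_def)
    then show ?thesis using 4 by (simp add: piece_def)
  next
    case 5
    then show ?thesis using m by (simp add: piece_def dvd_cancel)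
  next
    case 6
    obtain e where e: "j - 1 = i - 1 + Suc e" "bound m i j = e"
      using 6 less_iff_Suc_add[of "i - 1" "j - 1"] by (auto simp: bound_def)
    have yz: "\<not> y \<preceq> z" using r_not_dvd_initial[OF z] 6 m by (simp add: level_def)
    have "y [^] (j - 1) = y [^] (i - 1) \<otimes> y [^] Suc e" unfolding e by (rule nat_pow_mult[symmetric]) simp
    then have "y [^] (j - 1) \<otimes> w = y [^] (i - 1) \<otimes> (y [^] Suc e \<otimes> w)" by (simp add: m_assoc)
    then have "piece m i z \<preceq> piece m j w \<longleftrightarrow> z \<preceq> y [^] Suc e \<otimes> w"
      using 6 m by (simp add: piece_def dvd_cancel del: nat_pow_Suc)
    also have "\<dots> \<longleftrightarrow> z \<preceq> x [^] e"
    proof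
      assume "z \<preceq> y [^] Suc e \<otimes> w"
      then have "z \<preceq> r n \<otimes> (y [^] e \<otimes> w)" using pow_Suc_mult[of y w e] by simp
      then show "z \<preceq> x [^] e"
        using dvd_x_pow_of_dvd_r_y_pow[of n e w z] e yz yw 6 m ij n_pos by simp
    next
      assume "z \<preceq> x [^] e"
      then have "z \<preceq> y [^] Suc e" using dvd_trans[OF _ x_pow_dvd_y_pow] e ij m by simp
      then show "z \<preceq> y [^] Suc e \<otimes> w" using dvd_mult by simp
    qed
    finally show ?thesis using 6 e by simp
  next
    case 7
    then have "j - 1 < i - 1" by linarith
    then have "\<not> y [^] (i - 1) \<otimes> z \<preceq> y [^] (j - 1) \<otimes> w"
      using y_pow_dvd_y_pow[of "j - 1" "i - 1" w z] yw 7 by auto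
    then show ?thesis using 7 m by (simp add: piece_def dvd_cancel)
  qed
qed

lemma piece_top: "m \<le> n \<Longrightarrow> piece m (Suc m) \<one> = x [^] m"
  using x_pow_eq[of m] by (simp add: piece_def)

text \<open>For \<open>i \<le> m\<close> the number \<open>bound m i (Suc m)\<close> equals
  \<open>level m i\<close>, so all of piece \<open>i\<close> lies below the top element
  \<open>x^m\<close>.\<close>

lemma piece_initial:
  assumes "1 \<le> m" "m \<le> n" "i \<le> Suc m" "z \<in> initial (level m i)"
  shows "piece m i z \<in> initial m"
proof -
  have "piece m i z \<preceq> piece m (Suc m) \<one>"
    using piece_dvd_iff[OF assms(1-3) order_refl assms(4), of \<one>] assms initial_0
    by (auto simp: level_def initial_def bound_def min_def split: if_splits)
  then show ?thesis using assms piece_top by (auto simp: initial_def piece_closed)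
qed

text \<open>Without the divisor \<open>r m\<close>, \<open>dvd_x_pow_pred\<close> gives piece 0.
  Otherwise cancel \<open>r m\<close> in \<open>x^m = r m y^m\<close> and split off the power
  \<open>y^f\<close>; the rest divides \<open>x^(m - f - 1)\<close>, and \<open>f = m\<close> gives
  the top piece.\<close>

lemma initial_piece:
  assumes m: "1 \<le> m" "m \<le> n" and z: "z \<in> initial m"
  shows "\<exists>i\<le>Suc m. \<exists>w\<in>initial (level m i). z = piece m i w"
proof (cases "r m \<preceq> z")
  case False
  then have "z \<in> initial (m - 1)" using dvd_x_pow_pred[of m z] m z by (simp add: initial_def)
  then show ?thesis by (intro exI[of _ 0]) (auto simp: level_def piece_def)
next
  case True
  then obtain z' where z': "z' \<in> carrier G" "z = r m \<otimes> z'" unfolding factor_def by blast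
  then have "z' \<preceq> y [^] m" using z x_pow_eq[of m] m by (simp add: initial_def dvd_cancel)
  moreover obtain f :: nat and w where w: "w \<in> carrier G" "z' = y [^] f \<otimes> w" "\<not> y \<preceq> w"
    using y_exponent[OF z'(1)] by blast
  ultimately have fw: "y [^] f \<otimes> w \<preceq> y [^] m" by simp
  \<comment> \<open>Comparing weights bounds the number of factors \<open>y\<close> in
    front.\<close>
  then have "f * n + wt w \<le> m * n" using dvd_wt_le[OF fw] w by (simp add: wt_pow)
  then have "f * n \<le> m * n" by linarith
  then have f: "f \<le> m" using n_pos by simp
  then have "y [^] m = y [^] f \<otimes> y [^] (m - f)" by (simp add: nat_pow_mult)
  then have wy: "w \<preceq> y [^] (m - f)" using fw w by (simp add: dvd_cancel)
  have "w \<in> initial (m - Suc f)"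
  proof (cases "f = m")
    case True
    then show ?thesis using wy w dvd_one[of w] initial_0 by simp
  next
    case False
    then obtain e where e: "m - f = Suc e" using f by (cases "m - f") auto
    then have "w \<preceq> r n \<otimes> (y [^] e \<otimes> \<one>)" using wy pow_Suc_mult[of y \<one> e] by simp
    moreover have "\<not> y \<preceq> \<one>" using dvd_wt_le[of y \<one>] n_pos by auto
    ultimately have "w \<preceq> x [^] e"
      using dvd_x_pow_of_dvd_r_y_pow[of n e \<one> w] w e m n_pos by simp
    moreover have "m - Suc f = e" using e by arith
    ultimately show ?thesis using w by (simp add: initial_def)
  qed
  moreover have "z = piece m (Suc f) w" using z' w by (simp add: piece_def)
  ultimately show ?thesis using f by (intro exI[of _ "Suc f"] conjI bexI[of _ w]) (simp_all add: level_def)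
qed

lemma piece_inj:
  assumes m: "1 \<le> m" "m \<le> n" and ij: "i \<le> Suc m" "j \<le> Suc m"
    and z: "z \<in> initial (level m i)" and w: "w \<in> initial (level m j)"
    and eq: "piece m i z = piece m j w"
  shows "i = j \<and> z = w"
proof -
  have *: "piece m i z \<preceq> piece m j w" "piece m j w \<preceq> piece m i z"
    unfolding eq by (rule dvd_refl[OF piece_closed[OF m(2) initial_closed[OF w]]])+
  have "i = j \<and> z \<preceq> w \<and> w \<preceq> z"
    using iffD1[OF piece_dvd_iff[OF m ij z w] *(1)] iffD1[OF piece_dvd_iff[OF m ij(2,1) w z] *(2)]
    by auto
  then show ?thesis using dvd_antisym initial_closed[OF z] initial_closed[OF w] by blast
qed

end

subsection \<open>Independence of \<open>n\<close>\<close>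

definition div_iso ::
  "('a, 'x) monoid_scheme \<Rightarrow> 'a set \<Rightarrow> ('b, 'y) monoid_scheme \<Rightarrow> 'b set \<Rightarrow> ('a \<Rightarrow> 'b) \<Rightarrow> bool" where
  "div_iso G S H T f \<longleftrightarrow> bij_betw f S T \<and>
     (\<forall>z\<in>S. \<forall>w\<in>S. z divides\<^bsub>G\<^esub> w \<longleftrightarrow> f z divides\<^bsub>H\<^esub> f w)"

lemma level_less: "1 \<le> m \<Longrightarrow> level m i < m"
  by (simp add: level_def)

text \<open>Puts the power of \<open>x\<close> that compares two pieces among the divisors on which
  the isomorphism of the lower level is defined.\<close>

lemma bound_le_level: "i < j \<Longrightarrow> j \<le> Suc m \<Longrightarrow> bound m i j \<le> level m i"
  by (auto simp: level_def bound_def)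

locale rho_lcm_pair = A: rho_lcm_monoid G n r wt + B: rho_lcm_monoid H n' r' wt'
  for G (structure) and n r wt and H (structure) and n' r' wt'
begin

text \<open>The isomorphisms for smaller exponents are glued along the pieces. Tracking the powers
  of \<open>x\<close> closes the induction: \<open>piece_dvd_iff\<close> compares different pieces
  through them, and \<open>level\<close> and \<open>bound\<close> do not depend on
  \<open>n\<close>.\<close>

lemma initial_iso:
  "\<lbrakk>m \<le> n; m \<le> n'\<rbrakk> \<Longrightarrow> \<exists>f. div_iso G (A.initial m) H (B.initial m) f
    \<and> (\<forall>k\<le>m. f (A.x [^]\<^bsub>G\<^esub> k) = B.x [^]\<^bsub>H\<^esub> k)"
proof (induction m rule: less_induct)
  case (less m)
  show ?case
  proof (cases "m = 0")
    case True
    have "div_iso G (A.initial 0) H (B.initial 0) (\<lambda>_. \<one>\<^bsub>H\<^esub>)"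
      by (simp add: div_iso_def A.initial_0 B.initial_0 bij_betw_def A.dvd_refl B.dvd_refl)
    then show ?thesis using True by auto
  next
    case False
    then have m: "1 \<le> m" "m \<le> n" "m \<le> n'" using less.prems by auto
    have "\<exists>f. div_iso G (A.initial k) H (B.initial k) f
        \<and> (\<forall>j\<le>k. f (A.x [^]\<^bsub>G\<^esub> j) = B.x [^]\<^bsub>H\<^esub> j)" if "k < m" for k
      using less.IH[OF that] that less.prems by simp
    then obtain F where F: "\<And>k. k < m \<Longrightarrow> div_iso G (A.initial k) H (B.initial k) (F k)
        \<and> (\<forall>j\<le>k. F k (A.x [^]\<^bsub>G\<^esub> j) = B.x [^]\<^bsub>H\<^esub> j)"
      by metis
    then have Fx: "F k (A.x [^]\<^bsub>G\<^esub> j) = B.x [^]\<^bsub>H\<^esub> j" if "k < m" "j \<le> k" for k j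
      using that by blast
    from F have F: "div_iso G (A.initial k) H (B.initial k) (F k)" if "k < m" for k
      using that by blast
    have F_in: "F (level m i) z \<in> B.initial (level m i)" if "z \<in> A.initial (level m i)" for i z
      using F[OF level_less[OF m(1), of i]] that by (auto simp: div_iso_def bij_betw_def)
    have F_dvd: "F (level m i) z divides\<^bsub>H\<^esub> F (level m i) w \<longleftrightarrow> z divides\<^bsub>G\<^esub> w"
      if "z \<in> A.initial (level m i)" "w \<in> A.initial (level m i)" for i z w
      using F[OF level_less[OF m(1), of i]] that by (auto simp: div_iso_def)
    \<comment> \<open>The coordinates of an element are picked by \<open>SOME\<close>;
      \<open>piece_inj\<close> makes them unique.\<close>
    define f where "f c = (let p = SOME p. fst p \<le> Suc m \<and> snd p \<in> A.initial (level m (fst p))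
        \<and> c = A.piece m (fst p) (snd p) in B.piece m (fst p) (F (level m (fst p)) (snd p)))" for c
    have f: "f (A.piece m i z) = B.piece m i (F (level m i) z)"
      if iz: "i \<le> Suc m" "z \<in> A.initial (level m i)" for i z
    proof -
      have "(SOME p. fst p \<le> Suc m \<and> snd p \<in> A.initial (level m (fst p))
        \<and> A.piece m i z = A.piece m (fst p) (snd p)) = (i, z)"
      proof (rule some_equality)
        show "fst (i, z) \<le> Suc m \<and> snd (i, z) \<in> A.initial (level m (fst (i, z)))
            \<and> A.piece m i z = A.piece m (fst (i, z)) (snd (i, z))"
          using iz by simp
        show "p = (i, z)" if "fst p \<le> Suc m \<and> snd p \<in> A.initial (level m (fst p))
            \<and> A.piece m i z = A.piece m (fst p) (snd p)" for p
          using A.piece_inj[OF m(1,2) iz(1) _ iz(2), of "fst p" "snd p"] that by (cases p) auto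
      qed
      then show ?thesis by (simp add: f_def)
    qed
    have f_dvd: "c divides\<^bsub>G\<^esub> c' \<longleftrightarrow> f c divides\<^bsub>H\<^esub> f c'"
      if c: "c \<in> A.initial m" "c' \<in> A.initial m" for c c'
    proof -
      obtain i z where i: "i \<le> Suc m" "z \<in> A.initial (level m i)" "c = A.piece m i z"
        using A.initial_piece[OF m(1,2) c(1)] by blast
      obtain j w where j: "j \<le> Suc m" "w \<in> A.initial (level m j)" "c' = A.piece m j w"
        using A.initial_piece[OF m(1,2) c(2)] by blast
      have "F (level m i) z divides\<^bsub>H\<^esub> B.x [^]\<^bsub>H\<^esub> bound m i j
          \<longleftrightarrow> z divides\<^bsub>G\<^esub> A.x [^]\<^bsub>G\<^esub> bound m i j" if "i < j"
        using F_dvd[OF i(2) A.x_pow_initial] Fx[OF level_less[OF m(1)]]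
          bound_le_level[OF that j(1)] by simp
      moreover have "F (level m i) z divides\<^bsub>H\<^esub> F (level m j) w \<longleftrightarrow> z divides\<^bsub>G\<^esub> w" if "i = j"
        using F_dvd[OF i(2), of w] j that by simp
      ultimately show ?thesis
        unfolding i(3) j(3) f[OF i(1,2)] f[OF j(1,2)]
          A.piece_dvd_iff[OF m(1,2) i(1) j(1) i(2) j(2)]
          B.piece_dvd_iff[OF m(1,3) i(1) j(1) F_in[OF i(2)] F_in[OF j(2)]]
        by blast
    qed
    have "inj_on f (A.initial m)"
    proof (rule inj_onI)
      fix c c' assume c: "c \<in> A.initial m" "c' \<in> A.initial m" "f c = f c'"
      then have "c divides\<^bsub>G\<^esub> c'" "c' divides\<^bsub>G\<^esub> c"
        using f_dvd[OF c(1,1)] f_dvd[OF c(1,2)] f_dvd[OF c(2,1)] A.dvd_refl[OF A.initial_closed[OF c(1)]]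
        by simp_all
      then show "c = c'" by (rule A.dvd_antisym) (rule A.initial_closed[OF c(1)] A.initial_closed[OF c(2)])+
    qed
    moreover have "f ` A.initial m = B.initial m"
    proof (intro equalityI subsetI)
      fix c assume "c \<in> f ` A.initial m"
      then obtain b where b: "b \<in> A.initial m" "c = f b" by blast
      then obtain i z where i: "i \<le> Suc m" "z \<in> A.initial (level m i)" "b = A.piece m i z"
        using A.initial_piece[OF m(1,2)] by blast
      then show "c \<in> B.initial m"
        using b f[OF i(1,2)] B.piece_initial[OF m(1,3) i(1) F_in[OF i(2)]] by simp
    next
      fix c assume "c \<in> B.initial m"
      then obtain i w where i: "i \<le> Suc m" "w \<in> B.initial (level m i)" "c = B.piece m i w"
        using B.initial_piece[OF m(1,3)] by blast
      obtain z where z: "z \<in> A.initial (level m i)" "w = F (level m i) z"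
        using F[OF level_less[OF m(1), of i]] i(2) unfolding div_iso_def bij_betw_def by blast
      then have "c = f (A.piece m i z)" using f[OF i(1) z(1)] i(3) by simp
      then show "c \<in> f ` A.initial m" using A.piece_initial[OF m(1,2) i(1) z(1)] by blast
    qed
    ultimately have "div_iso G (A.initial m) H (B.initial m) f"
      using f_dvd by (auto simp: div_iso_def bij_betw_def)
    moreover have "f (A.x [^]\<^bsub>G\<^esub> k) = B.x [^]\<^bsub>H\<^esub> k" if "k \<le> m" for k
    \<comment> \<open>The power \<open>x^m\<close> is the top piece, of level 0; smaller powers lie
      in piece 0.\<close>
    proof (cases "k = m")
      case True
      have "F 0 \<one>\<^bsub>G\<^esub> = \<one>\<^bsub>H\<^esub>" using Fx[of 0 0] m by simp
      then show ?thesis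
        using f[of "Suc m" "\<one>\<^bsub>G\<^esub>"] A.piece_top[OF m(2)] B.piece_top[OF m(3)] A.initial_0 True
        by (simp add: level_def)
    next
      case False
      then have "k \<le> level m 0" using that by (simp add: level_def)
      then show ?thesis
        using f[of 0 "A.x [^]\<^bsub>G\<^esub> k"] A.x_pow_initial[of k "level m 0"] Fx[OF level_less[OF m(1)]]
        by (simp add: A.piece_def B.piece_def)
    qed
    ultimately show ?thesis by blast
  qed
qed

end

section \<open>Divisors of \<open>x^n\<close> sorted by their power of \<open>y\<close>\<close>

context rho_lcm_monoid
begin

lemma y_pow_Suc_n: "y [^] Suc n = x [^] n"
  using y_pow_Suc[of n] by simp

lemma Max_y_pow_dvd:
  assumes "z \<in> carrier G" "\<not> y \<preceq> z"
  shows "Max {k. y [^] k \<preceq> y [^] f \<otimes> z} = (f :: nat)"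
proof -
  have "k \<le> f" if "y [^] k \<preceq> y [^] f \<otimes> z" for k
    using y_pow_dvd_y_pow[of f k z \<one>] that assms by (cases "k \<le> f") auto
  moreover have "y [^] f \<preceq> y [^] f \<otimes> z" using assms dvd_mult_self by simp
  ultimately show ?thesis by (intro Max_eqI) (auto intro: finite_subset[of _ "{..f}"])
qed

lemma Max_y_pow_dvd_eq_iff:
  fixes i :: nat
  assumes "z \<in> carrier G"
  shows "Max {k. y [^] k \<preceq> z} = i \<longleftrightarrow> (\<exists>w\<in>carrier G. z = y [^] i \<otimes> w \<and> \<not> y \<preceq> w)"
proof
  obtain f :: nat and w where w: "w \<in> carrier G" "z = y [^] f \<otimes> w" "\<not> y \<preceq> w"
    using y_exponent[OF assms] by blast
  assume "Max {k. y [^] k \<preceq> z} = i"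
  then have "f = i" using Max_y_pow_dvd[OF w(1,3), of f] w(2) by simp
  then show "\<exists>w\<in>carrier G. z = y [^] i \<otimes> w \<and> \<not> y \<preceq> w" using w by blast
qed (use Max_y_pow_dvd in blast)

lemma initial_avoiding_y: "{z \<in> initial n. \<not> y \<preceq> z} = initial (n - 1)"
proof (intro equalityI subsetI)
  fix z assume "z \<in> initial (n - 1)"
  moreover from this have "z \<in> initial n"
    using dvd_trans[OF _ x_pow_dvd_x_pow[of "n - 1" n]] by (simp add: initial_def)
  ultimately show "z \<in> {z \<in> initial n. \<not> y \<preceq> z}" using r_not_dvd_initial[of z "n - 1" n] n_pos by simp
next
  fix z assume "z \<in> {z \<in> initial n. \<not> y \<preceq> z}"
  then show "z \<in> initial (n - 1)" using dvd_x_pow_pred[of n z] n_pos by (simp add: initial_def)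
qed

text \<open>As \<open>x^n = y^(n + 1)\<close>, cancelling \<open>y^i\<close> leaves the divisors
  \<open>w\<close> of \<open>y^(n - i + 1) = r n y^(n - i)\<close>. Those avoiding \<open>y\<close>
  divide \<open>x^(n - i)\<close> by \<open>dvd_x_pow_of_dvd_r_y_pow\<close>, and
  \<open>x^(n - i)\<close> divides \<open>y^(n - i + 1)\<close>.\<close>

lemma initial_y_exponent:
  assumes "1 \<le> i" "i \<le> n"
  shows "{z \<in> initial n. \<exists>w\<in>carrier G. z = y [^] i \<otimes> w \<and> \<not> y \<preceq> w} = (\<otimes>) (y [^] i) ` initial (n - i)"
proof -
  have y: "y [^] Suc n = y [^] i \<otimes> y [^] Suc (n - i)"
    unfolding nat_pow_mult[OF r_closed[OF order_refl]] using assms by simp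
  have "y [^] i \<otimes> w \<in> initial n \<and> \<not> y \<preceq> w \<longleftrightarrow> w \<in> initial (n - i)" if w: "w \<in> carrier G" for w
  proof -
    have *: "y [^] i \<otimes> w \<in> initial n \<longleftrightarrow> w \<preceq> y [^] Suc (n - i)"
      unfolding initial_def y_pow_Suc_n[symmetric] y using w by (simp add: dvd_cancel del: nat_pow_Suc)
    show ?thesis
    proof (intro iffI conjI)
      assume "y [^] i \<otimes> w \<in> initial n \<and> \<not> y \<preceq> w"
      then have "w \<preceq> r n \<otimes> (y [^] (n - i) \<otimes> \<one>)" "\<not> y \<preceq> w"
        using pow_Suc_mult[of y \<one> "n - i"] * by auto
      moreover have "\<not> y \<preceq> \<one>" using dvd_wt_le[of y \<one>] n_pos by auto
      ultimately show "w \<in> initial (n - i)"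
        using dvd_x_pow_of_dvd_r_y_pow[of n "n - i" \<one> w] w assms by (simp add: initial_def)
    next
      assume w': "w \<in> initial (n - i)"
      then show "\<not> y \<preceq> w" using r_not_dvd_initial[of w "n - i" n] assms by simp
      have "w \<preceq> y [^] Suc (n - i)"
        using w' dvd_trans[OF _ x_pow_dvd_y_pow[of "n - i"] w] by (simp add: initial_def del: nat_pow_Suc)
      then show "y [^] i \<otimes> w \<in> initial n" unfolding * .
    qed
  qed
  then show ?thesis using initial_closed by blast
qed

lemma initial_y_exponent_max:
  "{z \<in> initial n. \<exists>w\<in>carrier G. z = y [^] Suc n \<otimes> w \<and> \<not> y \<preceq> w} = {y [^] Suc n}"
proof -
  have "w = \<one>" if "y [^] Suc n \<otimes> w \<preceq> y [^] Suc n" "w \<in> carrier G" for w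
    using that dvd_cancel[of "y [^] Suc n" w \<one>] dvd_one by simp
  moreover have "\<not> y \<preceq> \<one>" using dvd_wt_le[of y \<one>] n_pos by auto
  ultimately show ?thesis
    unfolding initial_def y_pow_Suc_n[symmetric]
    by (fastforce simp: dvd_refl simp del: nat_pow_Suc intro: bexI[of _ \<one>])
qed

lemma div_iso_y_pow:
  assumes "S \<subseteq> carrier G"
  shows "div_iso G S G ((\<otimes>) (y [^] (i::nat)) ` S) ((\<otimes>) (y [^] i))"
proof -
  have "inj_on ((\<otimes>) (y [^] i)) S" using l_cancel[of "y [^] i"] assms by (auto intro!: inj_onI)
  then show ?thesis using assms by (auto simp: div_iso_def bij_betw_def dvd_cancel subset_eq)
qed

end

section \<open>Passage to the posets of the theorem\<close>

lemma div_iso_comp_inv: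
  assumes "div_iso G S H T f" "div_iso G S K U g"
  shows "div_iso H T K U (g \<circ> inv_into S f)"
proof -
  have f: "bij_betw f S T" and g: "bij_betw g S U" using assms by (auto simp: div_iso_def)
  have "z divides\<^bsub>H\<^esub> w \<longleftrightarrow> g (inv_into S f z) divides\<^bsub>K\<^esub> g (inv_into S f w)" if "z \<in> T" "w \<in> T" for z w
  proof -
    have "inv_into S f z \<in> S" "inv_into S f w \<in> S"
      and "f (inv_into S f z) = z" "f (inv_into S f w) = w"
      using f that by (auto simp: bij_betw_def f_inv_into_f inv_into_into)
    then show ?thesis using assms unfolding div_iso_def by metis
  qed
  then show ?thesis
    using bij_betw_trans[OF bij_betw_inv_into[OF f] g] by (auto simp: div_iso_def)
qed

lemma rho_lcm_monoid_M: "1 \<le> n \<Longrightarrow> rho_lcm_monoid (M n) n (rho0 n) (M_wt n)"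
  using rho_monoid_M M_lcm_below by (simp add: rho_lcm_monoid_def rho_lcm_monoid_axioms_def)

lemma M_0_carrier: "carrier (M 0) = {\<one>\<^bsub>M 0\<^esub>}"
  by (simp add: M_carrier M_one)

lemma Div_Delta_0: "Div_Delta 0 = {\<one>\<^bsub>M 0\<^esub>}"
  using monoid.Units_one_closed[OF monoid_M[of 0]] monoid.r_one[OF monoid_M[of 0], of "\<one>\<^bsub>M 0\<^esub>"]
  by (auto simp: Div_Delta_def Delta_def M_0_carrier factor_def)

lemma Div_Delta_initial:
  assumes "1 \<le> n"
  shows "Div_Delta n = rho_lcm_monoid.initial (M n) n (rho0 n) n"
proof -
  interpret rho_lcm_monoid "M n" n "rho0 n" "M_wt n" by (rule rho_lcm_monoid_M[OF assms])
  show ?thesis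
    using assms y_pow_Suc_n by (simp add: Div_Delta_def Delta_def initial_def rho0_def)
qed

text \<open>Compares \<open>M n\<close> with \<open>M m\<close>, where \<open>Delta m\<close> is
  itself the power \<open>x^m\<close>. The case \<open>m = 0\<close> is separate because
  \<open>rho_lcm_monoid\<close> requires a generator.\<close>

lemma initial_iso_Div_Delta:
  assumes "1 \<le> n" "m \<le> n"
  shows "\<exists>f. div_iso (M n) (rho_lcm_monoid.initial (M n) n (rho0 n) m) (M m) (Div_Delta m) f"
proof -
  interpret rho_lcm_monoid "M n" n "rho0 n" "M_wt n" by (rule rho_lcm_monoid_M[OF assms(1)])
  show ?thesis
  proof (cases "m = 0")
    case True
    have "\<one>\<^bsub>M 0\<^esub> divides\<^bsub>M 0\<^esub> \<one>\<^bsub>M 0\<^esub>" using Div_Delta_0 by (auto simp: Div_Delta_def Delta_def)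
    then have "div_iso (M n) (initial 0) (M 0) (Div_Delta 0) (\<lambda>_. \<one>\<^bsub>M 0\<^esub>)"
      by (auto simp: div_iso_def initial_0 Div_Delta_0 bij_betw_def dvd_refl)
    then show ?thesis using True by blast
  next
    case False
    then interpret m: rho_lcm_monoid "M m" m "rho0 m" "M_wt m" by (intro rho_lcm_monoid_M) simp
    interpret rho_lcm_pair "M n" n "rho0 n" "M_wt n" "M m" m "rho0 m" "M_wt m" ..
    show ?thesis using initial_iso[OF assms(2) order_refl] False by (auto simp: Div_Delta_initial)
  qed
qed

lemma M_dvd_antisym:
  assumes "z \<in> carrier (M n)" "w \<in> carrier (M n)" "z divides\<^bsub>M n\<^esub> w" "w divides\<^bsub>M n\<^esub> z"
  shows "z = w"
proof (cases "n = 0")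
  case False
  then interpret rho_lcm_monoid "M n" n "rho0 n" "M_wt n" by (intro rho_lcm_monoid_M) simp
  show ?thesis using dvd_antisym assms by blast
qed (use assms M_0_carrier in simp)

lemma partial_order_div_poset:
  assumes "S \<subseteq> carrier (M n)"
  shows "partial_order (div_poset n S)"
proof -
  interpret monoid "M n" by (rule monoid_M)
  show ?thesis
  proof (unfold_locales; unfold div_poset_def; simp)
    show "z divides\<^bsub>M n\<^esub> z" if "z \<in> S" for z
      using that assms by (auto simp: factor_def intro!: bexI[of _ "\<one>\<^bsub>M n\<^esub>"])
    show "z = w" if "z divides\<^bsub>M n\<^esub> w" "w divides\<^bsub>M n\<^esub> z" "z \<in> S" "w \<in> S" for z w
      using M_dvd_antisym that assms by blast
    show "z divides\<^bsub>M n\<^esub> v"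
      if "z divides\<^bsub>M n\<^esub> w" "w divides\<^bsub>M n\<^esub> v" "z \<in> S" "w \<in> S" "v \<in> S" for z w v
      using that assms by (auto simp: factor_def m_assoc subset_eq)
  qed
qed

lemma poset_isomorphic_div_iso:
  assumes "S \<subseteq> carrier (M n)" "T \<subseteq> carrier (M m)" "div_iso (M n) S (M m) T f"
  shows "poset_isomorphic (div_poset n S) (div_poset m T)"
  using assms partial_order_div_poset unfolding poset_isomorphic_def div_iso_def
  by (auto simp: div_poset_def)

theorem proposition3p16:
  fixes n :: nat
  assumes "n \<ge> 1"
  shows "(poset_isomorphic (div_poset n (D n 0)) (div_poset (n - 1) (Div_Delta (n - 1)))
      \<and> poset_isomorphic (div_poset n (D n (n + 1))) (div_poset 0 (Div_Delta 0))
      \<and> (\<exists>b. Div_Delta 0 = {b}))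
    \<and> (\<forall>i. 1 \<le> i \<and> i \<le> n \<longrightarrow>
          poset_isomorphic (div_poset n (D n i)) (div_poset (n - i) (Div_Delta (n - i))))"
proof -
  interpret rho_lcm_monoid "M n" n "rho0 n" "M_wt n" by (rule rho_lcm_monoid_M[OF assms])
  have D: "D n i = {z \<in> initial n. \<exists>w\<in>carrier (M n).
      z = y [^]\<^bsub>M n\<^esub> i \<otimes>\<^bsub>M n\<^esub> w \<and> \<not> y divides\<^bsub>M n\<^esub> w}" for i
  proof -
    have d: "d n z = Max {k. (y [^]\<^bsub>M n\<^esub> k) divides\<^bsub>M n\<^esub> z}" for z
      using assms by (simp add: d_def rho0_def)
    show ?thesis
      unfolding D_def Div_Delta_initial[OF assms] d
      by (rule Collect_cong, rule conj_cong[OF HOL.refl], rule Max_y_pow_dvd_eq_iff, rule initial_closed)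
  qed
  have D0: "D n 0 = initial (n - 1)"
  proof -
    have "(\<exists>w\<in>carrier (M n). z = y [^]\<^bsub>M n\<^esub> (0::nat) \<otimes>\<^bsub>M n\<^esub> w \<and> \<not> y divides\<^bsub>M n\<^esub> w)
        \<longleftrightarrow> \<not> y divides\<^bsub>M n\<^esub> z" if "z \<in> initial n" for z
      using initial_closed[OF that] by auto
    then show ?thesis unfolding initial_avoiding_y[symmetric] D by blast
  qed
  have Di: "D n i = (\<otimes>\<^bsub>M n\<^esub>) (y [^]\<^bsub>M n\<^esub> i) ` initial (n - i)" if "1 \<le> i" "i \<le> n" for i
    unfolding D using initial_y_exponent[OF that] .
  have Dn: "D n (n + 1) = {y [^]\<^bsub>M n\<^esub> Suc n}"
    unfolding D using initial_y_exponent_max by simp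
  have D_sub: "D n i \<subseteq> carrier (M n)" for i by (auto simp: D_def Div_Delta_def)
  have Div_sub: "Div_Delta k \<subseteq> carrier (M k)" for k by (auto simp: Div_Delta_def)
  note iso = poset_isomorphic_div_iso[OF D_sub Div_sub]
  have "poset_isomorphic (div_poset n (D n 0)) (div_poset (n - 1) (Div_Delta (n - 1)))"
    using iso[of 0 "n - 1"] initial_iso_Div_Delta[OF assms, of "n - 1"] unfolding D0 by auto
  moreover have "poset_isomorphic (div_poset n (D n (n + 1))) (div_poset 0 (Div_Delta 0))"
  proof (rule iso)
    have "\<one>\<^bsub>M 0\<^esub> divides\<^bsub>M 0\<^esub> \<one>\<^bsub>M 0\<^esub>" using Div_Delta_0 by (auto simp: Div_Delta_def Delta_def)
    then show "div_iso (M n) (D n (n + 1)) (M 0) (Div_Delta 0) (\<lambda>_. \<one>\<^bsub>M 0\<^esub>)"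
      unfolding Dn Div_Delta_0 by (simp add: div_iso_def bij_betw_def dvd_refl)
  qed
  moreover have "poset_isomorphic (div_poset n (D n i)) (div_poset (n - i) (Div_Delta (n - i)))"
    if i: "1 \<le> i" "i \<le> n" for i
  proof -
    \<comment> \<open>Two isomorphisms start from \<open>initial (n - i)\<close>: multiplication by
      \<open>y^i\<close> onto \<open>D n i\<close>, and \<open>f\<close> onto
      \<open>Div_Delta (n - i)\<close>. The first is inverted and followed by the second.\<close>
    obtain f where "div_iso (M n) (initial (n - i)) (M (n - i)) (Div_Delta (n - i)) f"
      using initial_iso_Div_Delta[OF assms, of "n - i"] by auto
    moreover have "initial (n - i) \<subseteq> carrier (M n)" using initial_closed by blast
    ultimately have "div_iso (M n) (D n i) (M (n - i)) (Div_Delta (n - i))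
        (f \<circ> inv_into (initial (n - i)) ((\<otimes>\<^bsub>M n\<^esub>) (y [^]\<^bsub>M n\<^esub> i)))"
      unfolding Di[OF i] by (intro div_iso_comp_inv[OF div_iso_y_pow])
    then show ?thesis by (rule iso)
  qed
  ultimately show ?thesis using Div_Delta_0 by blast
qed

end
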